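(* Let $H$ be a Hermitian function on $\mathbb{R}$ with $H\in C[0,\infty)$ which is an accelerant, i.e. $I+\mathcal{H}_r>0$ on $L^2[0,r]$ for every $r>0$, and let $A(r)=\Gamma_r(0,r)$ be the coefficient of the associated Krein system. Fix $R>0$, let $n\in\mathbb{N}$, $h=R/n$, and for $j=1,\dots,n$ consider the $(j+1)\times(j+1)$ Toeplitz matrix $\mathcal{T}_j$ with rows and columns indexed by $0,\dots,j$ and entries $$(\mathcal{T}_j)_{k,l}=hH((k-l)h)\ \ (k\ne l),\qquad (\mathcal{T}_j)_{k,k}=1 .$$ Then for $h$ small enough $\mathcal{T}_n>0$, and the Schur (Verblunsky) coefficients $\{a^{(h)}_j\}_{j=0}^{n-1}$ generated by $\mathcal{T}_n$ satisfy, for every small fixed $\delta>0$, $$\lim_{h\to0}\ \sup_{\delta<jh<R}\left|A(jh)-h^{-1}a^{(h)}_j\right|=0 .$$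
   Context: $H$ Hermitian means $H(-x)=\overline{H(x)}$ for $x\neq0$; $H\in C[0,\infty)$ means that $H$ is continuous on $(0,\infty)$ with finite limit $H(+0)$ (and $H(-0)=\overline{H(+0)}$, so a jump at $0$ is allowed). $(\mathcal{H}_rf)(x)=\int_0^rH(x-t)f(t)dt$ on $L^2[0,r]$. $\Gamma_r(t,s)$, $0\le s,t\le r$, is the resolvent kernel: $\Gamma_r(t,s)+\int_0^rH(t-u)\Gamma_r(u,s)du=H(t-s)$ (continuous in each of the closed triangles $s\le t$ and $s\ge t$). The Schur (Verblunsky) coefficients generated by the positive definite Toeplitz matrix $\mathcal{T}_n$ are, with $\mathcal{T}_0=(1)$, $$-\overline{a^{(h)}_{j-1}}=\frac{\det\mathcal{T}_j}{\det\mathcal{T}_{j-1}}\,(\mathcal{T}_j^{-1})_{j,0},\qquad j=1,\dots,n .$$ The limit $h\to0$ means $n\to\infty$ with $R$ fixed; $j$ is an integer. *)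

theory Defs
  imports "HOL-Analysis.Analysis" "Jordan_Normal_Form.Gauss_Jordan_Elimination"
    "Jordan_Normal_Form.Determinant"
begin

text \<open>The value of \<open>H\<close> at \<open>0\<close> is left arbitrary: it enters only through integrals, where it does
  not matter.\<close>

definition hermitian_fun :: "(real \<Rightarrow> complex) \<Rightarrow> bool" where
  "hermitian_fun H \<longleftrightarrow> (\<forall>x. x \<noteq> 0 \<longrightarrow> H (- x) = cnj (H x))"

definition continuous_half_line :: "(real \<Rightarrow> complex) \<Rightarrow> bool" where
  "continuous_half_line H \<longleftrightarrow>
     continuous_on {0<..} H \<and> (\<exists>L. (H \<longlongrightarrow> L) (at_right 0))"

definition conv_op :: "(real \<Rightarrow> complex) \<Rightarrow> real \<Rightarrow> (real \<Rightarrow> complex) \<Rightarrow> real \<Rightarrow> complex" where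
  "conv_op H r f x = (LINT t|lebesgue_on {0..r}. H (x - t) * f t)"

definition L2_on :: "real \<Rightarrow> (real \<Rightarrow> complex) set" where
  "L2_on r = {f. f \<in> borel_measurable (lebesgue_on {0..r}) \<and>
                 integrable (lebesgue_on {0..r}) (\<lambda>x. (cmod (f x))\<^sup>2)}"

text \<open>In the order on \<^typ>\<open>complex\<close> used here and below, \<open>0 < z\<close> means that \<open>z\<close> is real and
  positive.\<close>

definition accelerant :: "(real \<Rightarrow> complex) \<Rightarrow> bool" where
  "accelerant H \<longleftrightarrow>
     (\<forall>r>0. \<forall>f\<in>L2_on r. \<not> (AE x in lebesgue_on {0..r}. f x = 0) \<longrightarrow>
        0 < (LINT x|lebesgue_on {0..r}. (f x + conv_op H r f x) * cnj (f x)))"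

text \<open>Since \<open>H\<close> may jump at \<open>0\<close>, the kernel may jump across the diagonal, where its value plays no
  role. Continuity in a closed triangle means that the restriction to the triangle without
  the diagonal extends continuously to the closed triangle.\<close>

definition is_resolvent_kernel ::
    "(real \<Rightarrow> complex) \<Rightarrow> real \<Rightarrow> (real \<Rightarrow> real \<Rightarrow> complex) \<Rightarrow> bool" where
  "is_resolvent_kernel H r G \<longleftrightarrow>
     (\<forall>t\<in>{0..r}. \<forall>s\<in>{0..r}. t \<noteq> s \<longrightarrow>
        G t s + (LINT u|lebesgue_on {0..r}. H (t - u) * G u s) = H (t - s)) \<and>
     (\<exists>U. continuous_on {(t, s). 0 \<le> t \<and> t \<le> s \<and> s \<le> r} (\<lambda>(t, s). U t s) \<and>
          (\<forall>t s. 0 \<le> t \<and> t < s \<and> s \<le> r \<longrightarrow> G t s = U t s)) \<and>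
     (\<exists>L. continuous_on {(t, s). 0 \<le> s \<and> s \<le> t \<and> t \<le> r} (\<lambda>(t, s). L t s) \<and>
          (\<forall>t s. 0 \<le> s \<and> s < t \<and> t \<le> r \<longrightarrow> G t s = L t s))"

text \<open>For an accelerant the choice is unique off the diagonal of the square \<open>[0,r] \<times> [0,r]\<close>.\<close>

definition resolvent_kernel :: "(real \<Rightarrow> complex) \<Rightarrow> real \<Rightarrow> real \<Rightarrow> real \<Rightarrow> complex" where
  "resolvent_kernel H r = (SOME G. is_resolvent_kernel H r G)"

definition krein_coeff :: "(real \<Rightarrow> complex) \<Rightarrow> real \<Rightarrow> complex" where
  "krein_coeff H r = resolvent_kernel H r 0 r"

definition toeplitz_mat :: "(real \<Rightarrow> complex) \<Rightarrow> real \<Rightarrow> nat \<Rightarrow> complex mat" where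
  "toeplitz_mat H h j =
     mat (j + 1) (j + 1)
       (\<lambda>(k, l). if k = l then 1 else of_real h * H ((real k - real l) * h))"

definition pos_def_mat :: "complex mat \<Rightarrow> bool" where
  "pos_def_mat A \<longleftrightarrow>
     square_mat A \<and>
     (\<forall>v \<in> carrier_vec (dim_row A). v \<noteq> 0\<^sub>v (dim_row A) \<longrightarrow> 0 < (A *\<^sub>v v) \<bullet>c v)"

text \<open>The index is shifted: \<open>verblunsky H h j\<close> is built from the section of size \<open>j + 2\<close>. It is
  meaningful when that section is positive definite, hence invertible.\<close>

definition verblunsky :: "(real \<Rightarrow> complex) \<Rightarrow> real \<Rightarrow> nat \<Rightarrow> complex" where
  "verblunsky H h j =
     - cnj (Determinant.det (toeplitz_mat H h (j + 1)) / Determinant.det (toeplitz_mat H h j)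
            * the (mat_inverse (toeplitz_mat H h (j + 1))) $$ (j + 1, 0))"

end

theory Submission
  imports Defs "HOL-Complex_Analysis.Great_Picard"
begin

text \<open>
  The Toeplitz system solved by the first column of \<open>T\<^sub>j\<^sup>-\<^sup>1\<close> is a discretisation, by step
  functions, of the integral equation for the column \<open>\<Gamma>\<^sub>r(\<cdot>, r)\<close>, and \<open>h\<^sup>-\<^sup>1 a\<^sub>j\<close> is the value at
  \<open>0\<close> of its solution. Replacing \<open>H\<close> by its step approximation changes the operator by a quantity
  that is small in the sup norm, uniformly in \<open>r\<close>, because \<open>H\<close> is uniformly continuous on either side
  of its jump. So everything rests on a lower bound \<open>c \<parallel>f\<parallel> \<le> \<parallel>f + s \<H>\<^sub>r f\<parallel>\<close> in the sup norm that is
  uniform in \<open>r \<le> B\<close> and \<open>s \<in> [0, 1]\<close>: it follows from the injectivity of these operators by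
  compactness (Arzela--Ascoli). The parameter \<open>s\<close> serves twice: for the existence of the resolvent
  kernel, by the method of continuity, and for the positivity of the Toeplitz matrices, which have no
  eigenvalue \<open>m \<le> 0\<close> because such an eigenvector is a null vector for \<open>s = 1 / (1 - m)\<close>.
\<close>

text \<open>The quantity to be approximated is a point value, so stability is needed in the sup
  norm, whereas the accelerant condition is an \<open>L2_on\<close> statement. The two meet only in
  injectivity, where positivity is tested on one continuous function. The lower bound has to apply
  to the difference of a step function and a column of the kernel, so it is stated for bounded
  measurable functions. These have no compactness of their own, but their convolutions are
  equicontinuous, and the equation itself recovers the limit of the functions from the limit of the
  convolutions.

  The comparison of the two equations is off by one cell. The system behind
  \<open>verblunsky H h j\<close> has \<open>j + 1\<close> unknowns, hence cells covering
  \<open>[0, (j + 1) * h]\<close>, and its right-hand side refers to the node \<open>j + 1\<close>;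
  the Krein coefficient belongs to \<open>r = j * h\<close>. The extra cell and the shifted
  right-hand side are absorbed as small perturbations.\<close>

section \<open>Integrals over a bounded interval\<close>

lemma integrable_bounded_interval:
  fixes f :: "real \<Rightarrow> 'b::{banach, second_countable_topology}"
  assumes [measurable]: "f \<in> borel_measurable borel"
    and b: "\<And>t. t \<in> {0..r} \<Longrightarrow> norm (f t) \<le> C"
  shows "integrable (lebesgue_on {0..r}) f"
proof -
  interpret finite_measure "lebesgue_on {0..r::real}"
    by (rule finite_measure_lebesgue_on) auto
  have m: "f \<in> borel_measurable (lebesgue_on {0..r})"
    by (intro measurable_restrict_space1 measurable_completion) simp
  show ?thesis
    by (rule integrable_const_bound[where B = C]) (use b m in \<open>auto simp: AE_restrict_space_iff\<close>)
qed

text \<open>The shape of every kernel estimate below: a small bound \<open>u\<close> everywhere,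
  plus a crude bound \<open>v\<close> on an interval of length \<open>2 * d\<close> around the jump.
  The crude part is harmless because the interval is short.\<close>

lemma norm_integral_peak_bound:
  fixes f :: "real \<Rightarrow> 'b::{banach, second_countable_topology}"
  assumes f: "f \<in> borel_measurable borel"
    and b: "\<And>t. t \<in> {0..r} \<Longrightarrow> norm (f t) \<le> u + v * indicator {x - d..x + d} t"
    and nn: "0 \<le> v" "0 \<le> d" "0 \<le> r"
  shows "norm (LINT t|lebesgue_on {0..r}. f t) \<le> u * r + 2 * v * d"
proof -
  interpret finite_measure "lebesgue_on {0..r::real}"
    by (rule finite_measure_lebesgue_on) auto
  let ?g = "\<lambda>t. u + v * indicator {x - d..x + d} t :: real"
  have g: "integrable (lebesgue_on {0..r}) ?g"
    by (rule integrable_bounded_interval[where C = "\<bar>u\<bar> + \<bar>v\<bar>"]) (auto simp: indicator_def)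
  have "norm (f t) \<le> \<bar>u\<bar> + \<bar>v\<bar>" if "t \<in> {0..r}" for t
    using b[OF that] by (cases "t \<in> {x - d..x + d}") auto
  then have fi: "integrable (lebesgue_on {0..r}) f"
    by (intro integrable_bounded_interval[OF f])
  have "norm (LINT t|lebesgue_on {0..r}. f t) \<le> (LINT t|lebesgue_on {0..r}. ?g t)"
    by (rule Bochner_Integration.integral_norm_bound_integral[OF fi g]) (use b in auto)
  also have "\<dots> = (LINT t|lebesgue_on {0..r}. u)
      + (LINT t|lebesgue_on {0..r}. v * indicator {x - d..x + d} t)"
    by (rule Bochner_Integration.integral_add)
      (auto intro!: integrable_bounded_interval[where C = "1 + \<bar>v\<bar>"] simp: indicator_def)
  also have "(LINT t|lebesgue_on {0..r}. u) = u * r"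
    using nn by (simp add: measure_restrict_space)
  also have "(LINT t|lebesgue_on {0..r}. v * indicator {x - d..x + d} t)
      = v * measure lebesgue ({x - d..x + d} \<inter> {0..r})"
    by (simp add: measure_restrict_space)
  also have "\<dots> \<le> v * (2 * d)"
    using nn by (intro mult_left_mono) auto
  finally show ?thesis by simp
qed

section \<open>The method of continuity\<close>

text \<open>The a priori bound makes the inverse Lipschitz with constant \<open>1 / c\<close> at
  every \<open>s\<close> where the equation is solvable. Hence solvability spreads by a step that
  does not depend on \<open>s\<close>, and finitely many steps lead from \<open>0\<close> to
  \<open>1\<close>.\<close>

lemma method_of_continuity:
  fixes T :: "'a::{real_normed_vector, complete_space} \<Rightarrow> 'a"
  assumes T: "bounded_linear T" and c: "c > 0"
    and b: "\<And>s f. \<lbrakk>0 \<le> s; s \<le> 1\<rbrakk> \<Longrightarrow> c * norm f \<le> norm (f + s *\<^sub>R T f)"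
  shows "\<exists>f. f + T f = g"
proof -
  interpret bounded_linear T by fact
  obtain B where B: "B > 0" "\<And>f. norm (T f) \<le> norm f * B"
    using pos_bounded by blast
  define d where "d = c / (2 * B)"
  have d: "d > 0" using B c by (simp add: d_def)
  define P where "P s \<longleftrightarrow> (\<forall>g. \<exists>f. f + s *\<^sub>R T f = g)" for s
  have step: "P s'" if s: "0 \<le> s" "s \<le> 1" and P: "P s" and s': "\<bar>s' - s\<bar> \<le> d" for s s'
    unfolding P_def
  proof
    fix g
    obtain S where S: "\<And>g. S g + s *\<^sub>R T (S g) = g" using P unfolding P_def by metis
    have Sb: "norm (S a - S b) \<le> norm (a - b) / c" for a b
    proof -
      have "(S a - S b) + s *\<^sub>R T (S a - S b) = a - b"
        using S[of a] S[of b] by (simp add: diff scaleR_diff_right algebra_simps)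
      then have "c * norm (S a - S b) \<le> norm (a - b)" using assms(3)[OF s, of "S a - S b"] by metis
      then show ?thesis using c by (simp add: field_simps)
    qed
    \<comment> \<open>A fixed point solves
      \<open>f + s *\<^sub>R T f = g - (s' - s) *\<^sub>R T f\<close>, which is the equation at
      \<open>s'\<close>. The choice of \<open>d\<close> makes the map a contraction by
      \<open>1 / 2\<close>.\<close>
    have "\<exists>!f. S (g - (s' - s) *\<^sub>R T f) = f"
    proof (rule banach_fix_type[where c = "1/2"])
      show "\<forall>x y. dist (S (g - (s' - s) *\<^sub>R T x)) (S (g - (s' - s) *\<^sub>R T y)) \<le> 1 / 2 * dist x y"
      proof (intro allI)
        fix x y
        have "dist (S (g - (s' - s) *\<^sub>R T x)) (S (g - (s' - s) *\<^sub>R T y))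
            \<le> norm ((g - (s' - s) *\<^sub>R T x) - (g - (s' - s) *\<^sub>R T y)) / c"
          unfolding dist_norm by (rule Sb)
        also have "(g - (s' - s) *\<^sub>R T x) - (g - (s' - s) *\<^sub>R T y) = - ((s' - s) *\<^sub>R T (x - y))"
          by (simp add: diff algebra_simps)
        also have "norm \<dots> / c = \<bar>s' - s\<bar> * norm (T (x - y)) / c" by simp
        also have "\<dots> \<le> d * (norm (x - y) * B) / c"
          using s' B(2)[of "x - y"] c d by (intro divide_right_mono mult_mono) auto
        also have "\<dots> = 1 / 2 * dist x y" using c B by (simp add: d_def dist_norm)
        finally show "dist (S (g - (s' - s) *\<^sub>R T x)) (S (g - (s' - s) *\<^sub>R T y)) \<le> 1 / 2 * dist x y" .
      qed
    qed auto
    then obtain f where "S (g - (s' - s) *\<^sub>R T f) = f" by blast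
    then have "f + s *\<^sub>R T f = g - (s' - s) *\<^sub>R T f" using S by metis
    then show "\<exists>f. f + s' *\<^sub>R T f = g" by (intro exI[of _ f]) (simp add: algebra_simps)
  qed
  have "P (min 1 (real m * d))" for m
  proof (induction m)
    case 0
    then show ?case by (auto simp: P_def)
  next
    case (Suc m)
    show ?case by (rule step[OF _ _ Suc]) (use d in \<open>auto simp: min_def algebra_simps\<close>)
  qed
  moreover obtain m :: nat where "1 < real m * d" using d ex_less_of_nat_mult by blast
  ultimately have "P 1" by (metis min.absorb1 less_imp_le)
  then show ?thesis by (auto simp: P_def)
qed

section \<open>The kernel with a jump and its convolution operator\<close>

text \<open>The value at \<open>0\<close> is the limit from the left, which makes the kernel uniformly continuous on
  \<open>(-\<infinity>, 0]\<close>.\<close>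

definition jump_kernel :: "(real \<Rightarrow> complex) \<Rightarrow> real \<Rightarrow> complex" where
  "jump_kernel p x = (if x > 0 then p x else cnj (p (- x)))"

text \<open>What the analysis needs to know about the accelerant. Here \<open>p\<close> lives on the
  whole line, so that the arguments of the kernel need no range conditions. Injectivity concerns
  continuous functions because the limit produced by the compactness argument is continuous.\<close>

locale convolution =
  fixes p :: "real \<Rightarrow> complex" and M B :: real
  assumes p_unif: "uniformly_continuous_on UNIV p"
    and p_bound: "cmod (p x) \<le> M"
    and injective: "\<lbrakk>0 < r; r \<le> B; 0 \<le> s; s \<le> 1; continuous_on UNIV f;
        \<And>x. x \<in> {0..r} \<Longrightarrow>
          f x + of_real s * (LINT t|lebesgue_on {0..r}. jump_kernel p (x - t) * f t) = 0;
        y \<in> {0..r}\<rbrakk> \<Longrightarrow> f y = 0"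
begin

abbreviation "K \<equiv> jump_kernel p"

definition conv :: "real \<Rightarrow> (real \<Rightarrow> complex) \<Rightarrow> real \<Rightarrow> complex" where
  "conv r f x = (LINT t|lebesgue_on {0..r}. K (x - t) * f t)"

lemma M_nonneg: "0 \<le> M"
  using p_bound[of 0] norm_ge_zero order_trans by blast

lemma K_bound: "cmod (K x) \<le> M"
  by (simp add: jump_kernel_def p_bound)

lemma p_continuous: "continuous_on UNIV p"
  by (rule uniformly_continuous_imp_continuous[OF p_unif])

lemma K_measurable [measurable]: "K \<in> borel_measurable borel"
proof -
  have [measurable]: "p \<in> borel_measurable borel"
    by (rule borel_measurable_continuous_onI[OF p_continuous])
  have [measurable]: "cnj \<in> borel_measurable borel"
    by (intro borel_measurable_continuous_onI continuous_intros)
  show ?thesis unfolding jump_kernel_def[abs_def] by measurable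
qed

text \<open>The condition \<open>\<bar>z - w\<bar> < \<bar>z\<bar>\<close> puts both points strictly
  on one side of the jump. The second alternative admits \<open>0\<close> together with the negative
  side, where \<open>K\<close> takes its left limit; this covers the right end of the column at
  \<open>r\<close>.\<close>

lemma K_modulus:
  assumes "e > 0"
  obtains d where "d > 0"
    "\<And>z w. \<lbrakk>\<bar>z - w\<bar> \<le> d; \<bar>z - w\<bar> < \<bar>z\<bar> \<or> z \<le> 0 \<and> w \<le> 0\<rbrakk> \<Longrightarrow> cmod (K z - K w) \<le> e"
proof -
  obtain d where d: "d > 0" "\<And>x y. \<bar>x - y\<bar> < d \<Longrightarrow> cmod (p x - p y) < e"
    using p_unif assms unfolding uniformly_continuous_on_def dist_norm
    by (metis UNIV_I real_norm_def)
  have "cmod (K z - K w) \<le> e"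
    if "\<bar>z - w\<bar> \<le> d / 2" and zw: "\<bar>z - w\<bar> < \<bar>z\<bar> \<or> z \<le> 0 \<and> w \<le> 0" for z w
  proof -
    from that d have lt: "\<bar>z - w\<bar> < d" "\<bar>- z - (- w)\<bar> < d" by linarith+
    consider "z > 0" "w > 0" | "z \<le> 0" "w \<le> 0" using zw by linarith
    then show ?thesis
    proof cases
      case 1
      then show ?thesis using d(2)[OF lt(1)] by (simp add: jump_kernel_def)
    next
      case 2
      then have "cmod (K z - K w) = cmod (cnj (p (- z) - p (- w)))" by (simp add: jump_kernel_def)
      then show ?thesis using d(2)[OF lt(2)] by (simp only: complex_mod_cnj)
    qed
  qed
  with d show ?thesis by (intro that[of "d / 2"]) auto
qed

lemma conv_integrable:
  assumes [measurable]: "f \<in> borel_measurable borel" and "\<And>t. t \<in> {0..r} \<Longrightarrow> cmod (f t) \<le> C"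
  shows "integrable (lebesgue_on {0..r}) (\<lambda>t. K (x - t) * f t)"
proof (rule integrable_bounded_interval)
  show "cmod (K (x - t) * f t) \<le> M * C" if "t \<in> {0..r}" for t
    using assms(2)[OF that] K_bound M_nonneg by (auto simp: norm_mult intro!: mult_mono)
qed measurable

lemma conv_cong: "(\<And>t. t \<in> {0..r} \<Longrightarrow> f t = g t) \<Longrightarrow> conv r f x = conv r g x"
  unfolding conv_def by (rule Bochner_Integration.integral_cong) auto

lemma conv_scale: "conv r (\<lambda>t. c * f t) x = c * conv r f x"
proof -
  have "conv r (\<lambda>t. c * f t) x = (LINT t|lebesgue_on {0..r}. c * (K (x - t) * f t))"
    unfolding conv_def by (rule Bochner_Integration.integral_cong) auto
  then show ?thesis unfolding conv_def by simp
qed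

lemma conv_diff:
  assumes "f \<in> borel_measurable borel" "\<And>t. t \<in> {0..r} \<Longrightarrow> cmod (f t) \<le> C"
    and "g \<in> borel_measurable borel" "\<And>t. t \<in> {0..r} \<Longrightarrow> cmod (g t) \<le> D"
  shows "conv r (\<lambda>t. f t - g t) x = conv r f x - conv r g x"
  unfolding conv_def right_diff_distrib
  by (rule Bochner_Integration.integral_diff) (rule conv_integrable[OF assms(1,2)] conv_integrable[OF assms(3,4)], assumption)+

lemma conv_add:
  assumes "f \<in> borel_measurable borel" "\<And>t. t \<in> {0..r} \<Longrightarrow> cmod (f t) \<le> C"
    and "g \<in> borel_measurable borel" "\<And>t. t \<in> {0..r} \<Longrightarrow> cmod (g t) \<le> D"
  shows "conv r (\<lambda>t. f t + g t) x = conv r f x + conv r g x"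
  unfolding conv_def distrib_left
  by (rule Bochner_Integration.integral_add) (rule conv_integrable[OF assms(1,2)] conv_integrable[OF assms(3,4)], assumption)+

lemma conv_bound:
  assumes [measurable]: "f \<in> borel_measurable borel" and b: "\<And>t. t \<in> {0..r} \<Longrightarrow> cmod (f t) \<le> C" and "0 \<le> r"
  shows "cmod (conv r f x) \<le> M * C * r"
proof -
  have "cmod (LINT t|lebesgue_on {0..r}. K (x - t) * f t) \<le> (M * C) * r + 2 * 0 * 0"
  proof (rule norm_integral_peak_bound[where x = 0])
    show "cmod (K (x - t) * f t) \<le> M * C + 0 * indicat_real {0 - 0..0 + 0} t" if "t \<in> {0..r}" for t
      using b[OF that] K_bound M_nonneg by (auto simp: norm_mult intro!: mult_mono)
  qed (use assms in measurable)
  then show ?thesis by (simp add: conv_def)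
qed

text \<open>Used twice: \<open>k\<close> is a translate of the kernel for equicontinuity, and a step
  kernel for the discretisation.\<close>

lemma norm_kernel_integral_diff:
  assumes [measurable]: "k \<in> borel_measurable borel" "f \<in> borel_measurable borel"
    and k: "\<And>t. t \<in> {0..r} \<Longrightarrow> cmod (K (x - t) - k t) \<le> e + 2 * M * indicator {y - d..y + d} t"
    and f: "\<And>t. t \<in> {0..r} \<Longrightarrow> cmod (f t) \<le> C"
    and nn: "0 \<le> d" "0 \<le> r" "0 \<le> e"
  shows "cmod (conv r f x - (LINT t|lebesgue_on {0..r}. k t * f t)) \<le> (e * r + 4 * M * d) * C"
proof -
  have C: "0 \<le> C" using f[of 0] nn by (auto intro: order_trans[OF norm_ge_zero])
  have kb: "cmod (k t * f t) \<le> (M + (e + 2 * M)) * C" if "t \<in> {0..r}" for t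
  proof -
    have "cmod (k t) \<le> cmod (K (x - t)) + cmod (K (x - t) - k t)"
      by (metis norm_minus_commute norm_triangle_sub)
    also have "\<dots> \<le> M + (e + 2 * M)"
      using k[OF that] K_bound[of "x - t"] M_nonneg
      by (cases "t \<in> {y - d..y + d}") auto
    finally show ?thesis
      using f[OF that] M_nonneg nn by (auto simp: norm_mult intro!: mult_mono)
  qed
  have ki: "integrable (lebesgue_on {0..r}) (\<lambda>t. k t * f t)"
    by (rule integrable_bounded_interval[OF _ kb]) measurable
  have "conv r f x - (LINT t|lebesgue_on {0..r}. k t * f t)
      = (LINT t|lebesgue_on {0..r}. K (x - t) * f t - k t * f t)"
    unfolding conv_def
    by (rule Bochner_Integration.integral_diff[symmetric]) (use conv_integrable[OF assms(2) f] ki in auto)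
  also have "\<dots> = (LINT t|lebesgue_on {0..r}. (K (x - t) - k t) * f t)"
    by (simp add: algebra_simps)
  also have "cmod \<dots> \<le> (e * C) * r + 2 * (2 * M * C) * d"
  proof (rule norm_integral_peak_bound[where x = y])
    fix t assume t: "t \<in> {0..r}"
    have "cmod ((K (x - t) - k t) * f t) \<le> (e + 2 * M * indicator {y - d..y + d} t) * C"
      unfolding norm_mult using k[OF t] f[OF t] C nn M_nonneg by (intro mult_mono) auto
    then show "cmod ((K (x - t) - k t) * f t) \<le> e * C + 2 * M * C * indicat_real {y - d..y + d} t"
      by (simp add: algebra_simps)
  qed (use nn M_nonneg C in \<open>measurable, auto\<close>)
  finally show ?thesis by (simp add: algebra_simps)
qed

text \<open>If \<open>z\<close> is farther than \<open>a\<close> from the jump, a move by at most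
  \<open>a\<close> cannot cross it; otherwise the trivial bound \<open>2 * M\<close>
  applies.\<close>

lemma K_diff_peak:
  assumes "e > 0"
  obtains d where "d > 0"
    "\<And>z w a. \<lbrakk>\<bar>z - w\<bar> \<le> a; a \<le> d\<rbrakk> \<Longrightarrow> cmod (K z - K w) \<le> e + 2 * M * indicator {- a..a} z"
proof -
  obtain d where d: "d > 0"
    "\<And>z w. \<lbrakk>\<bar>z - w\<bar> \<le> d; \<bar>z - w\<bar> < \<bar>z\<bar> \<or> z \<le> 0 \<and> w \<le> 0\<rbrakk> \<Longrightarrow> cmod (K z - K w) \<le> e"
    using K_modulus[OF assms] by blast
  show ?thesis
  proof (rule that[OF d(1)])
    fix z w a :: real assume a: "\<bar>z - w\<bar> \<le> a" "a \<le> d"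
    show "cmod (K z - K w) \<le> e + 2 * M * indicator {- a..a} z"
    proof (cases "z \<in> {- a..a}")
      case True
      then show ?thesis
        using norm_triangle_ineq4[of "K z" "K w"] K_bound[of z] K_bound[of w] assms by simp
    next
      case False
      with a have "\<bar>z - w\<bar> < \<bar>z\<bar>" by auto
      with False a d(2)[of z w] show ?thesis by auto
    qed
  qed
qed

lemma conv_equicontinuous:
  assumes "e > 0" "0 \<le> B"
  obtains d where "d > 0"
    "\<And>r f C x y. \<lbrakk>0 \<le> r; r \<le> B; f \<in> borel_measurable borel; \<And>t. t \<in> {0..r} \<Longrightarrow> cmod (f t) \<le> C;
      \<bar>x - y\<bar> \<le> d\<rbrakk> \<Longrightarrow> cmod (conv r f x - conv r f y) \<le> e * C"
proof -
  \<comment> \<open>\<open>e' * r\<close> and \<open>4 * M * d\<close> are each to stay below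
    \<open>e / 2\<close>; the summands \<open>1\<close> keep the denominators positive.\<close>
  define e' where "e' = e / (2 * (B + 1))"
  have e': "e' > 0" using assms by (simp add: e'_def)
  obtain d0 where d0: "d0 > 0"
    "\<And>z w a. \<lbrakk>\<bar>z - w\<bar> \<le> a; a \<le> d0\<rbrakk> \<Longrightarrow> cmod (K z - K w) \<le> e' + 2 * M * indicator {- a..a} z"
    using K_diff_peak[OF e'] by blast
  define d where "d = min d0 (e / (8 * (M + 1)))"
  have d: "d > 0" using d0 assms M_nonneg by (simp add: d_def)
  show ?thesis
  proof (rule that[OF d])
    fix r f C x y
    assume r: "0 \<le> r" "r \<le> B" and f [measurable]: "f \<in> borel_measurable borel"
      and fb: "\<And>t. t \<in> {0..r} \<Longrightarrow> cmod (f t) \<le> C" and xy: "\<bar>x - y\<bar> \<le> d"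
    have C: "0 \<le> C" using fb[of 0] r by (auto intro: order_trans[OF norm_ge_zero])
    have "cmod (conv r f x - (LINT t|lebesgue_on {0..r}. K (y - t) * f t)) \<le> (e' * r + 4 * M * d) * C"
    proof (rule norm_kernel_integral_diff[where y = x])
      fix t
      have "cmod (K (x - t) - K (y - t)) \<le> e' + 2 * M * indicator {- d..d} (x - t)"
        by (rule d0(2)) (use xy in \<open>auto simp: d_def\<close>)
      also have "indicator {- d..d} (x - t) = (indicator {x - d..x + d} t :: real)"
        by (auto simp: indicator_def)
      finally show "cmod (K (x - t) - K (y - t)) \<le> e' + 2 * M * indicator {x - d..x + d} t" .
    qed (use fb r e' d in auto)
    also have "\<dots> \<le> e * C"
    proof (rule mult_right_mono[OF _ C])
      have "e' * r \<le> e' * (B + 1)" using r e' by (intro mult_left_mono) auto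
      also have "\<dots> = e / 2" using assms by (simp add: e'_def field_simps)
      finally have 1: "e' * r \<le> e / 2" .
      have "4 * M * d \<le> 4 * (M + 1) * (e / (8 * (M + 1)))"
        using M_nonneg d by (intro mult_mono) (auto simp: d_def)
      also have "\<dots> = e / 2" using M_nonneg by (simp add: field_simps)
      finally show "e' * r + 4 * M * d \<le> e" using 1 by simp
    qed
    finally show "cmod (conv r f x - conv r f y) \<le> e * C" by (simp add: conv_def)
  qed
qed

end

section \<open>The uniform lower bound in the sup norm\<close>

lemma borel_measurable_lebesgue_on_borel:
  assumes "f \<in> borel_measurable borel"
  shows "f \<in> borel_measurable (lebesgue_on S)"
  by (intro measurable_restrict_space1 measurable_completion) (use assms in simp)

lemma AE_lebesgue_on_neq: "AE x in lebesgue_on {a..b::real}. x \<noteq> c"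
proof -
  have "AE x in lebesgue. x \<noteq> c"
    by (rule AE_completion[OF AE_lborel_singleton])
  then show ?thesis by (subst AE_restrict_space_iff) auto
qed

context convolution
begin

text \<open>Replaces the varying interval by the fixed \<open>[0, B]\<close>, so that a sequence
  with different \<open>r\<close> can be treated by one operator.\<close>

lemma conv_cutoff:
  assumes "r \<le> B"
  shows "conv B (\<lambda>t. indicator {0..r} t *\<^sub>R f t) x = conv r f x"
proof -
  have eq: "indicator {0..B} t *\<^sub>R (K (x - t) * (indicator {0..r} t *\<^sub>R f t))
      = indicator {0..r} t *\<^sub>R (K (x - t) * f t)" for t
    using assms by (auto simp: indicator_def)
  have 1: "conv r' g x = (LINT t|lebesgue. indicator {0..r'} t *\<^sub>R (K (x - t) * g t))" for r' g
    unfolding conv_def by (rule integral_restrict_space) auto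
  show ?thesis unfolding 1 eq ..
qed

text \<open>The functions \<open>F n\<close> are normalised counterexamples with residuals tending
  to \<open>0\<close>. Arzela-Ascoli is applied to their convolutions, with limit \<open>g\<close>;
  then \<open>F n\<close> is close to \<open>- s n\<close> times its convolution, which gives its
  pointwise limit. Dominated convergence turns this limit into a solution of the homogeneous
  equation on \<open>[0, r0]\<close>.\<close>

lemma conv_lower_bound_aux:
  assumes B: "0 \<le> B"
    and r: "\<And>n. 0 \<le> r n" "\<And>n. r n \<le> B" and s: "\<And>n. 0 \<le> s n" "\<And>n. s n \<le> (1::real)"
    and F: "\<And>n. F n \<in> borel_measurable borel" "\<And>n t. cmod (F n t) \<le> 1"
      "\<And>n t. t > r n \<Longrightarrow> F n t = 0"
    and small: "\<And>n t. t \<in> {0..r n} \<Longrightarrow> cmod (F n t + of_real (s n) * conv B (F n) t) \<le> inverse (real (Suc n))"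
    and y: "\<And>n. y n \<in> {0..r n}" "\<And>n. cmod (F n (y n)) \<ge> 1/2"
  shows False
proof -
  obtain g k where g: "continuous_on {0..B} g" and k: "strict_mono (k :: nat \<Rightarrow> nat)"
    and lim: "\<And>e. 0 < e \<Longrightarrow> \<exists>N. \<forall>n x. n \<ge> N \<and> x \<in> {0..B} \<longrightarrow> norm (conv B (F (k n)) x - g x) < e"
  proof (rule Arzela_Ascoli[of "{0..B}" "\<lambda>n. conv B (F n)" "M * 1 * B"])
    show "norm (conv B (F n) x) \<le> M * 1 * B" for n x
      by (rule conv_bound) (use F B in auto)
    show "\<exists>d>0. \<forall>n y. y \<in> {0..B} \<and> norm (x - y) < d \<longrightarrow> norm (conv B (F n) x - conv B (F n) y) < e"
      if "e > 0" for x e :: real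
    proof -
      obtain d where d: "d > 0"
        "\<And>r f C x y. \<lbrakk>0 \<le> r; r \<le> B; f \<in> borel_measurable borel; \<And>t. t \<in> {0..r} \<Longrightarrow> cmod (f t) \<le> C;
          \<bar>x - y\<bar> \<le> d\<rbrakk> \<Longrightarrow> cmod (conv r f x - conv r f y) \<le> e / 2 * C"
        using conv_equicontinuous[OF half_gt_zero[OF \<open>e > 0\<close>] B] by blast
      have "cmod (conv B (F n) x - conv B (F n) y) < e" if "\<bar>x - y\<bar> < d" for n y
      proof -
        have "cmod (conv B (F n) x - conv B (F n) y) \<le> e / 2 * 1"
          by (rule d(2)) (use B F that in auto)
        then show ?thesis using \<open>e > 0\<close> by simp
      qed
      then show ?thesis using d(1) by auto
    qed
  qed auto
  have "seq_compact ({0..B} \<times> {0..1::real})"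
    by (intro compact_imp_seq_compact compact_Times) auto
  moreover have "\<forall>n. (r (k n), s (k n)) \<in> {0..B} \<times> {0..1}" using r s by auto
  ultimately obtain z m where z: "z \<in> {0..B} \<times> {0..1}" and m: "strict_mono (m :: nat \<Rightarrow> nat)"
    and zlim: "((\<lambda>n. (r (k n), s (k n))) \<circ> m) \<longlonglongrightarrow> z"
    by (rule seq_compactE)
  obtain r0 s0 where z_eq: "z = (r0, s0)" by (cases z)
  define l where "l n = k (m n)" for n
  have l: "strict_mono l" using k m by (auto simp: l_def strict_mono_def)
  have rlim: "(\<lambda>n. r (l n)) \<longlonglongrightarrow> r0" and slim: "(\<lambda>n. s (l n)) \<longlonglongrightarrow> s0"
    using tendsto_fst[OF zlim] tendsto_snd[OF zlim] by (simp_all add: l_def o_def z_eq)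
  have r0: "0 \<le> r0" "r0 \<le> B" and s0: "0 \<le> s0" "s0 \<le> 1" using z by (auto simp: z_eq)
  have llim: "\<exists>N. \<forall>n\<ge>N. \<forall>x\<in>{0..B}. cmod (conv B (F (l n)) x - g x) < e" if "e > 0" for e
    using lim[OF that] m unfolding l_def by (meson order_trans seq_suble)
  have ptlim: "(\<lambda>n. conv B (F (l n)) x) \<longlonglongrightarrow> g x" if "x \<in> {0..B}" for x
    unfolding LIMSEQ_iff using llim that by blast
  \<comment> \<open>Clamping extends the limit continuously to the whole line, as
    \<open>injective\<close> requires.\<close>
  define f where "f t = - of_real s0 * g (max 0 (min B t))" for t
  have fc: "continuous_on UNIV f" unfolding f_def
    by (intro continuous_intros continuous_on_compose2[OF g]) (use B in auto)
  have f_eq: "f t = - of_real s0 * g t" if "t \<in> {0..B}" for t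
    using that by (simp add: f_def)
  obtain C where C: "\<And>t. cmod (f t) \<le> C"
  proof -
    have "compact (g ` {0..B})" by (intro compact_continuous_image g) auto
    then obtain D where D: "\<And>t. t \<in> {0..B} \<Longrightarrow> cmod (g t) \<le> D"
      using compact_imp_bounded bounded_iff by (metis imageI)
    have "cmod (f t) \<le> 1 * D" for t
      unfolding f_def norm_mult using D[of "max 0 (min B t)"] s0 B by (intro mult_mono) auto
    then show ?thesis using that by blast
  qed
  have fm [measurable]: "f \<in> borel_measurable borel" by (rule borel_measurable_continuous_onI[OF fc])
  note F(1) [measurable]
  have inv: "(\<lambda>n. inverse (real (Suc (l n)))) \<longlonglongrightarrow> 0"
    using LIMSEQ_subseq_LIMSEQ[OF LIMSEQ_inverse_real_of_nat l] by (simp add: o_def)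
  \<comment> \<open>At \<open>t = r0\<close> the cutoffs \<open>r (l n)\<close> may lie on either
    side, so no limit is claimed there; a single point does not affect the integral.\<close>
  have Flim: "(\<lambda>n. F (l n) t) \<longlonglongrightarrow> indicator {0..r0} t *\<^sub>R f t" if t: "t \<in> {0..B}" "t \<noteq> r0" for t
  proof (cases "t < r0")
    case True
    have ev: "\<forall>\<^sub>F n in sequentially. t < r (l n)" using order_tendstoD(1)[OF rlim True] .
    have "(\<lambda>n. F (l n) t + of_real (s (l n)) * conv B (F (l n)) t) \<longlonglongrightarrow> 0"
      by (rule Lim_null_comparison[OF _ inv])
        (use ev in eventually_elim, use small t in auto)
    from tendsto_diff[OF this tendsto_mult[OF tendsto_of_real[OF slim] ptlim[OF t(1)]]]
    show ?thesis using True t by (simp add: f_eq)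
  next
    case False
    then have ev: "\<forall>\<^sub>F n in sequentially. r (l n) < t" using order_tendstoD(2)[OF rlim, of t] t by auto
    have "\<forall>\<^sub>F n in sequentially. F (l n) t = 0"
      using ev by eventually_elim (rule F(3))
    then have "(\<lambda>n. F (l n) t) \<longlonglongrightarrow> 0" by (rule tendsto_eventually)
    then show ?thesis using False t by (simp add: indicator_def)
  qed
  have g_eq: "g x = conv r0 f x" if x: "x \<in> {0..B}" for x
  proof -
    have "(\<lambda>n. conv B (F (l n)) x) \<longlonglongrightarrow> conv B (\<lambda>t. indicator {0..r0} t *\<^sub>R f t) x"
      unfolding conv_def
    proof (rule integral_dominated_convergence[where w = "\<lambda>_. M"])
      show "(\<lambda>t. K (x - t) * (indicator {0..r0} t *\<^sub>R f t)) \<in> borel_measurable (lebesgue_on {0..B})"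
        by (rule borel_measurable_lebesgue_on_borel) measurable
      show "(\<lambda>t. K (x - t) * F (l n) t) \<in> borel_measurable (lebesgue_on {0..B})" for n
        by (rule borel_measurable_lebesgue_on_borel) measurable
      show "integrable (lebesgue_on {0..B}) (\<lambda>_. M)"
        by (rule integrable_bounded_interval[where C = M]) (use M_nonneg in auto)
      have "cmod (K (x - t) * F (l n) t) \<le> M * 1" for t n
        unfolding norm_mult using K_bound F(2) M_nonneg by (intro mult_mono) auto
      then show "AE t in lebesgue_on {0..B}. cmod (K (x - t) * F (l n) t) \<le> M" for n by simp
      show "AE t in lebesgue_on {0..B}. (\<lambda>n. K (x - t) * F (l n) t)
          \<longlonglongrightarrow> K (x - t) * (indicator {0..r0} t *\<^sub>R f t)"
        using AE_lebesgue_on_neq[where a = 0 and b = B and c = r0] AE_space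
        by eventually_elim (intro tendsto_mult tendsto_const Flim; simp)
    qed
    then show ?thesis using ptlim[OF x] conv_cutoff[OF r0(2)] LIMSEQ_unique by metis
  qed
  \<comment> \<open>Vanishing is required on all of \<open>[0, B]\<close>, since the points
    \<open>y (l n)\<close> may lie beyond \<open>r0\<close>. The case \<open>r0 = 0\<close> is
    separate because \<open>injective\<close> asks for a nondegenerate interval; there the integral
    is \<open>0\<close> by its size.\<close>
  have g0: "g x = 0" if x: "x \<in> {0..B}" for x
  proof (cases "r0 = 0")
    case True
    have "cmod (conv r0 f x) \<le> M * C * r0" using C r0 by (intro conv_bound) auto
    then show ?thesis using True g_eq[OF x] by simp
  next
    case False
    have "f y = 0" if "y \<in> {0..r0}" for y
    proof (rule injective[OF _ r0(2) s0 fc _ that])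
      show "f x + of_real s0 * (LINT t|lebesgue_on {0..r0}. K (x - t) * f t) = 0" if "x \<in> {0..r0}" for x
        using that r0 g_eq[of x] by (simp add: f_eq conv_def)
    qed (use False r0 in auto)
    then have "conv r0 f x = conv r0 (\<lambda>t. 0) x" by (rule conv_cong)
    then show ?thesis using g_eq[OF x] by (simp add: conv_def)
  qed
  \<comment> \<open>A residual and a convolution both below \<open>1/8\<close> are incompatible with
    a value of modulus at least \<open>1/2\<close> at \<open>y\<close>.\<close>
  obtain N where N: "\<And>n x. n \<ge> N \<Longrightarrow> x \<in> {0..B} \<Longrightarrow> cmod (conv B (F (l n)) x - g x) < 1/8"
    using llim[of "1/8"] by (metis zero_less_divide_1_iff zero_less_numeral)
  obtain N' where N': "\<And>n. n \<ge> N' \<Longrightarrow> inverse (real (Suc (l n))) < 1/8"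
    using order_tendstoD(2)[OF inv, of "1/8"] by (auto simp: eventually_sequentially)
  define n where "n = max N N'"
  define u where "u = y (l n)"
  have u: "u \<in> {0..r (l n)}" "u \<in> {0..B}" using y(1)[of "l n"] r(2)[of "l n"] by (auto simp: u_def)
  have 1: "cmod (F (l n) u + of_real (s (l n)) * conv B (F (l n)) u) < 1/8"
    using small[OF u(1)] N'[of n] by (simp add: n_def)
  have 2: "cmod (conv B (F (l n)) u) < 1/8" using N[of n u] u(2) g0[OF u(2)] by (simp add: n_def)
  have 3: "cmod (of_real (s (l n)) * conv B (F (l n)) u) \<le> 1 * cmod (conv B (F (l n)) u)"
    unfolding norm_mult using s[of "l n"] by (intro mult_right_mono) auto
  have "cmod (F (l n) u) \<le> cmod (F (l n) u + of_real (s (l n)) * conv B (F (l n)) u)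
      + cmod (of_real (s (l n)) * conv B (F (l n)) u)"
    by (metis add_diff_cancel_right' norm_triangle_ineq4)
  with 1 2 3 y(2)[of "l n"] show False by (simp add: u_def)
qed

text \<open>Negating the bound for each \<open>c = 1 / (n + 1)\<close> and dividing by the supremum
  yields the sequence excluded above. The bound \<open>C\<close> only makes the supremum finite;
  \<open>c\<close> does not depend on it.\<close>

lemma conv_lower_bound:
  assumes B: "0 \<le> B"
  obtains c where "c > 0"
    "\<And>r s f C e x. \<lbrakk>0 \<le> r; r \<le> B; 0 \<le> s; s \<le> 1; f \<in> borel_measurable borel;
      \<And>t. t \<in> {0..r} \<Longrightarrow> cmod (f t) \<le> C;
      \<And>t. t \<in> {0..r} \<Longrightarrow> cmod (f t + of_real s * conv r f t) \<le> e; x \<in> {0..r}\<rbrakk> \<Longrightarrow> c * cmod (f x) \<le> e"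
proof (rule ccontr)
  assume neg: "\<not> thesis"
  have "\<exists>r s F y. 0 \<le> r \<and> r \<le> B \<and> 0 \<le> s \<and> s \<le> (1::real) \<and> F \<in> borel_measurable borel \<and>
      (\<forall>t. cmod (F t) \<le> 1) \<and> (\<forall>t>r. F t = 0) \<and>
      (\<forall>t\<in>{0..r}. cmod (F t + of_real s * conv B F t) \<le> inverse (real (Suc n))) \<and>
      y \<in> {0..r} \<and> cmod (F y) \<ge> 1/2" for n
  proof -
    define c where "c = inverse (real (Suc n))"
    have c: "c > 0" by (simp add: c_def)
    from neg that[OF c] obtain r s f C e x where
      r: "0 \<le> r" "r \<le> B" and s: "0 \<le> s" "s \<le> 1" and f [measurable]: "f \<in> borel_measurable borel"
      and fC: "\<And>t. t \<in> {0..r} \<Longrightarrow> cmod (f t) \<le> C"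
      and fe: "\<And>t. t \<in> {0..r} \<Longrightarrow> cmod (f t + of_real s * conv r f t) \<le> e"
      and x: "x \<in> {0..r}" and ex: "\<not> c * cmod (f x) \<le> e"
      by metis
    \<comment> \<open>The supremum of a merely measurable function may not be attained, so a point
      with value above \<open>S / 2\<close> has to do; this is the origin of \<open>1/2\<close> in
      the compactness argument.\<close>
    define S where "S = (SUP t\<in>{0..r}. cmod (f t))"
    have bdd: "bdd_above ((\<lambda>t. cmod (f t)) ` {0..r})" using fC by (auto intro!: bdd_aboveI[of _ C])
    have fS: "cmod (f t) \<le> S" if "t \<in> {0..r}" for t
      unfolding S_def by (rule cSUP_upper[OF that bdd])
    have e: "0 \<le> e" using fe[OF x] by (rule order_trans[OF norm_ge_zero])
    have "f x \<noteq> 0" using ex e by auto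
    then have S: "S > 0" using fS[OF x] by (meson less_le_trans zero_less_norm_iff)
    have eS: "e \<le> c * S" using ex mult_left_mono[OF fS[OF x], of c] c by linarith
    have "S / 2 < (SUP t\<in>{0..r}. cmod (f t))" unfolding S_def[symmetric] using S by simp
    then obtain y where y: "y \<in> {0..r}" "S / 2 < cmod (f y)"
      using less_cSUP_iff[OF _ bdd, of "S / 2"] r by auto
    define F where "F t = indicator {0..r} t *\<^sub>R (inverse (complex_of_real S) * f t)" for t
    have Fm: "F \<in> borel_measurable borel" unfolding F_def[abs_def] by measurable
    have Fin: "F t = inverse (complex_of_real S) * f t" if "t \<in> {0..r}" for t using that by (simp add: F_def)
    have Fconv: "conv B F t = inverse (complex_of_real S) * conv r f t" for t
      unfolding F_def[abs_def] conv_cutoff[OF r(2)] by (rule conv_scale)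
    have "cmod (F t) \<le> 1" for t
      using fS[of t] S by (cases "t \<in> {0..r}") (auto simp: F_def norm_mult norm_divide norm_inverse field_simps)
    moreover have "F t = 0" if "t > r" for t using that by (simp add: F_def)
    moreover have "cmod (F t + of_real s * conv B F t) \<le> c" if t: "t \<in> {0..r}" for t
    proof -
      have "F t + of_real s * conv B F t = inverse (complex_of_real S) * (f t + of_real s * conv r f t)"
        by (simp add: Fin[OF t] Fconv algebra_simps)
      then have "cmod (F t + of_real s * conv B F t) = inverse S * cmod (f t + of_real s * conv r f t)"
        using S by (simp add: norm_mult norm_inverse)
      also have "\<dots> \<le> inverse S * (c * S)"
        using fe[OF t] eS S by (intro mult_left_mono) auto
      also have "\<dots> = c" using S by simp
      finally show ?thesis .
    qed
    moreover have "cmod (F y) \<ge> 1/2"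
      using y S by (simp add: Fin norm_mult norm_divide norm_inverse field_simps)
    ultimately show ?thesis using r s Fm y(1) unfolding c_def
      by (intro exI[of _ r] exI[of _ s] exI[of _ F] exI[of _ y]) auto
  qed
  then obtain r s F y where
    "\<And>n. 0 \<le> r n \<and> r n \<le> B \<and> 0 \<le> s n \<and> s n \<le> (1::real) \<and> F n \<in> borel_measurable borel \<and>
      (\<forall>t. cmod (F n t) \<le> 1) \<and> (\<forall>t>r n. F n t = 0) \<and>
      (\<forall>t\<in>{0..r n}. cmod (F n t + of_real (s n) * conv B (F n) t) \<le> inverse (real (Suc n))) \<and>
      y n \<in> {0..r n} \<and> cmod (F n (y n)) \<ge> 1/2"
    by metis
  then show False by (intro conv_lower_bound_aux[OF B, of r s F y]) auto
qed


section \<open>Existence of the resolvent kernel\<close>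

lemma conv_continuous:
  assumes "0 \<le> r" "r \<le> B" and f: "f \<in> borel_measurable borel" "\<And>t. t \<in> {0..r} \<Longrightarrow> cmod (f t) \<le> C"
  shows "continuous_on UNIV (conv r f)"
  unfolding continuous_on_iff
proof (intro ballI allI impI)
  fix x e :: real assume e: "e > 0"
  have C: "0 \<le> C" using f(2)[of 0] assms(1) by (auto intro: order_trans[OF norm_ge_zero])
  have eC: "e / (C + 1) > 0" and B: "0 \<le> B" using e C assms by auto
  obtain d where d: "d > 0"
    "\<And>r f D x y. \<lbrakk>0 \<le> r; r \<le> B; f \<in> borel_measurable borel; \<And>t. t \<in> {0..r} \<Longrightarrow> cmod (f t) \<le> D;
      \<bar>x - y\<bar> \<le> d\<rbrakk> \<Longrightarrow> cmod (conv r f x - conv r f y) \<le> e / (C + 1) * D"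
    using conv_equicontinuous[OF eC B] by blast
  have "dist (conv r f y) (conv r f x) < e" if "dist y x < d" for y
  proof -
    have "cmod (conv r f y - conv r f x) \<le> e / (C + 1) * C"
      by (rule d(2)[OF assms]) (use that in \<open>auto simp: dist_norm\<close>)
    also have "\<dots> < e" using e C by (simp add: field_simps)
    finally show ?thesis by (simp add: dist_norm)
  qed
  then show "\<exists>d>0. \<forall>x'\<in>UNIV. dist x' x < d \<longrightarrow> dist (conv r f x') (conv r f x) < e"
    using d(1) by auto
qed

lemma bcontfun_borel: "apply_bcontfun f \<in> borel_measurable borel"
  by (rule borel_measurable_continuous_onI) auto

text \<open>The operator acts on functions on the whole line, though it sees only their values on
  \<open>[0, r]\<close>; this gives a single Banach space for all \<open>r\<close>.\<close>

definition conv_bc :: "real \<Rightarrow> (real \<Rightarrow>\<^sub>C complex) \<Rightarrow> (real \<Rightarrow>\<^sub>C complex)" where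
  "conv_bc r f = Bcontfun (conv r (apply_bcontfun f))"

lemma conv_in_bcontfun:
  assumes "0 \<le> r" "r \<le> B" "f \<in> borel_measurable borel" "\<And>t. cmod (f t) \<le> C"
  shows "conv r f \<in> bcontfun"
  by (rule bcontfun_normI[OF conv_continuous conv_bound[of f r C]]) (use assms in auto)

lemma apply_conv_bc:
  assumes "0 \<le> r" "r \<le> B"
  shows "apply_bcontfun (conv_bc r f) x = conv r (apply_bcontfun f) x"
  unfolding conv_bc_def
  by (subst Bcontfun_inverse) (use conv_in_bcontfun[OF assms bcontfun_borel norm_bounded] in auto)

lemma bounded_linear_conv_bc:
  assumes r: "0 \<le> r" "r \<le> B"
  shows "bounded_linear (conv_bc r)"
proof (rule bounded_linear_intro[where K = "M * r"])
  show "conv_bc r (f + g) = conv_bc r f + conv_bc r g" for f g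
    by (rule bcontfun_eqI)
      (simp add: apply_conv_bc[OF r] conv_add[OF bcontfun_borel norm_bounded bcontfun_borel norm_bounded])
  show "conv_bc r (a *\<^sub>R f) = a *\<^sub>R conv_bc r f" for a f
    by (rule bcontfun_eqI) (simp add: apply_conv_bc[OF r] conv_scale scaleR_conv_of_real)
  show "norm (conv_bc r f) \<le> norm f * (M * r)" for f
  proof (rule norm_bound)
    show "norm (apply_bcontfun (conv_bc r f) x) \<le> norm f * (M * r)" for x
      using conv_bound[OF bcontfun_borel norm_bounded r(1), of f] by (simp add: apply_conv_bc[OF r] mult_ac)
  qed
qed

text \<open>The earlier bound controls \<open>f\<close> on \<open>[0, r]\<close> only. Elsewhere
  \<open>f\<close> is the residual minus \<open>s\<close> times its convolution, and the convolution
  depends on \<open>f\<close> on \<open>[0, r]\<close> alone; this produces the factor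
  \<open>q = 1 + M * B / c\<close>.\<close>

lemma conv_bc_lower_bound:
  assumes "0 \<le> B"
  obtains c where "c > 0"
    "\<And>r s f. \<lbrakk>0 \<le> r; r \<le> B; 0 \<le> s; s \<le> 1\<rbrakk> \<Longrightarrow> c * norm f \<le> norm (f + s *\<^sub>R conv_bc r f)"
proof -
  obtain c where c: "c > 0"
    "\<And>r s f C e x. \<lbrakk>0 \<le> r; r \<le> B; 0 \<le> s; s \<le> 1; f \<in> borel_measurable borel;
      \<And>t. t \<in> {0..r} \<Longrightarrow> cmod (f t) \<le> C;
      \<And>t. t \<in> {0..r} \<Longrightarrow> cmod (f t + of_real s * conv r f t) \<le> e; x \<in> {0..r}\<rbrakk> \<Longrightarrow> c * cmod (f x) \<le> e"
    using conv_lower_bound[OF assms] by metis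
  define q where "q = 1 + M * B / c"
  have q: "q > 0" using M_nonneg assms c(1) by (auto simp: q_def intro!: add_pos_nonneg)
  show ?thesis
  proof (rule that[of "inverse q"])
    fix r s :: real and f :: "real \<Rightarrow>\<^sub>C complex" assume r: "0 \<le> r" "r \<le> B" and s: "0 \<le> s" "s \<le> 1"
    let ?e = "norm (f + s *\<^sub>R conv_bc r f)"
    have val: "apply_bcontfun (f + s *\<^sub>R conv_bc r f) x = apply_bcontfun f x + of_real s * conv r (apply_bcontfun f) x" for x
      by (simp add: apply_conv_bc[OF r] scaleR_conv_of_real)
    have eb: "cmod (apply_bcontfun f x + of_real s * conv r (apply_bcontfun f) x) \<le> ?e" for x
      unfolding val[symmetric] by (rule norm_bounded)
    have fb: "cmod (apply_bcontfun f x) \<le> ?e / c" if "x \<in> {0..r}" for x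
      using c(2)[OF r s bcontfun_borel norm_bounded eb that] c(1) by (simp add: field_simps)
    have "norm f \<le> q * ?e"
    proof (rule norm_bound)
      fix x
      have "cmod (of_real s * conv r (apply_bcontfun f) x) \<le> 1 * (M * (?e / c) * r)"
        unfolding norm_mult using s conv_bound[OF bcontfun_borel fb r(1)] by (intro mult_mono) auto
      also have "\<dots> \<le> M * (?e / c) * B"
        unfolding mult_1 by (rule mult_left_mono[OF r(2)]) (use M_nonneg c(1) in auto)
      finally have "cmod (of_real s * conv r (apply_bcontfun f) x) \<le> M * (?e / c) * B" .
      moreover have "cmod (apply_bcontfun f x) \<le> cmod (apply_bcontfun f x + of_real s * conv r (apply_bcontfun f) x)
          + cmod (of_real s * conv r (apply_bcontfun f) x)"
        by (metis add_diff_cancel_right' norm_triangle_ineq4)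
      ultimately show "cmod (apply_bcontfun f x) \<le> q * ?e"
        using eb[of x] by (simp add: q_def algebra_simps)
    qed
    then show "inverse q * norm f \<le> ?e" using q by (simp add: field_simps)
  qed (use q in auto)
qed

text \<open>The kernel inherits the jump of \<open>K (t - s)\<close>, so it is not itself a family
  of continuous functions. After subtracting it from \<open>K (t - s)\<close>, the remainder
  \<open>k\<close> satisfies \<open>k s + conv r (k s) = conv r (\<lambda>u. K (u - s))\<close>,
  with a continuous right-hand side. Joint continuity of \<open>k\<close> follows from the Lipschitz
  solution operator and the continuous dependence of the right-hand side on
  \<open>s\<close>.\<close>

lemma exists_resolvent_kernel:
  assumes r: "0 \<le> r" "r \<le> B"
  obtains k where "continuous_on UNIV (\<lambda>(t, s). k s t)"
    "\<And>s t. K (t - s) - k s t + conv r (\<lambda>u. K (u - s) - k s u) t = K (t - s)"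
proof -
  have B: "0 \<le> B" using r by simp
  obtain c where c: "c > 0"
    "\<And>r s f. \<lbrakk>0 \<le> r; r \<le> B; 0 \<le> s; s \<le> 1\<rbrakk> \<Longrightarrow> c * norm f \<le> norm (f + s *\<^sub>R conv_bc r f)"
    using conv_bc_lower_bound[OF B] by metis
  interpret T: bounded_linear "conv_bc r" by (rule bounded_linear_conv_bc[OF r])
  have "\<exists>f. f + conv_bc r f = g" for g
    by (rule method_of_continuity[OF T.bounded_linear_axioms c(1)]) (use c(2) r in auto)
  then obtain S where S: "\<And>g. S g + conv_bc r (S g) = g" by metis
  have S_lip: "c * norm (S a - S b) \<le> norm (a - b)" for a b
  proof -
    have "(S a - S b) + 1 *\<^sub>R conv_bc r (S a - S b) = a - b"
      using S[of a] S[of b] by (simp add: T.diff) (metis add_diff_add)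
    then show ?thesis using c(2)[OF r, of 1 "S a - S b"] by simp
  qed
  have Km: "(\<lambda>u. K (u - s)) \<in> borel_measurable borel" for s by measurable
  define b where "b s = Bcontfun (conv r (\<lambda>u. K (u - s)))" for s
  have b: "apply_bcontfun (b s) x = conv r (\<lambda>u. K (u - s)) x" for s x
    unfolding b_def
    by (subst Bcontfun_inverse) (use conv_in_bcontfun[OF r Km K_bound] in auto)
  \<comment> \<open>Here the translated factor is the function being convolved, not the kernel, so
    equicontinuity of \<open>conv\<close> does not apply. The peak estimate is used directly,
    centred at the jump \<open>u = s'\<close>.\<close>
  have b_cont: "\<exists>d>0. \<forall>s'. \<bar>s' - s\<bar> < d \<longrightarrow> norm (b s' - b s) < e" if e: "e > 0" for s e
  proof -
    define e' where "e' = e / (4 * (M + 1) * (B + 1))"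
    have cancel: "a * (e / (4 * a * b)) * b = e / 4" if "a > 0" "b > 0" for a b :: real
      using that by simp
    have cancel2: "2 * (a * (2 * a)) * (e / (16 * a * a)) = e / 4" if "a > 0" for a :: real
      using that by simp
    have e': "e' > 0" using e B M_nonneg by (simp add: e'_def)
    obtain d0 where d0: "d0 > 0"
      "\<And>z w a. \<lbrakk>\<bar>z - w\<bar> \<le> a; a \<le> d0\<rbrakk> \<Longrightarrow> cmod (K z - K w) \<le> e' + 2 * M * indicator {- a..a} z"
      using K_diff_peak[OF e'] by blast
    define d where "d = min d0 (e / (16 * (M + 1) * (M + 1)))"
    have d: "d > 0" using d0 e M_nonneg by (simp add: d_def)
    have "norm (b s' - b s) < e" if "\<bar>s' - s\<bar> < d" for s'
    proof -
      have "norm (b s' - b s) \<le> e / 2"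
      proof (rule norm_bound)
        fix x
        have 1: "conv r (\<lambda>u. K (u - s')) x - conv r (\<lambda>u. K (u - s)) x
            = conv r (\<lambda>u. K (u - s') - K (u - s)) x"
          by (rule conv_diff[symmetric, OF Km K_bound Km K_bound])
        have "cmod (conv r (\<lambda>u. K (u - s') - K (u - s)) x) \<le> (M * e') * r + 2 * (M * (2 * M)) * d"
          unfolding conv_def
        proof (rule norm_integral_peak_bound[where x = s'])
          fix u
          have "cmod (K (u - s') - K (u - s)) \<le> e' + 2 * M * indicator {- d..d} (u - s')"
            by (rule d0(2)) (use that in \<open>auto simp: d_def\<close>)
          also have "indicator {- d..d} (u - s') = (indicator {s' - d..s' + d} u :: real)"
            by (auto simp: indicator_def)
          finally have "cmod (K (x - u) * (K (u - s') - K (u - s))) \<le> M * (e' + 2 * M * indicator {s' - d..s' + d} u)"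
            unfolding norm_mult using K_bound M_nonneg by (intro mult_mono) auto
          then show "cmod (K (x - u) * (K (u - s') - K (u - s))) \<le> M * e' + M * (2 * M) * indicat_real {s' - d..s' + d} u"
            by (simp add: algebra_simps)
        qed (use d r M_nonneg in auto)
        also have "\<dots> \<le> e / 2"
        proof -
          have "M * e' * r \<le> (M + 1) * e' * (B + 1)" using r M_nonneg e' by (intro mult_mono) auto
          also have "\<dots> = e / 4"
            unfolding e'_def by (rule cancel) (use M_nonneg B in auto)
          finally have 1: "M * e' * r \<le> e / 4" .
          have "2 * (M * (2 * M)) * d \<le> 2 * ((M + 1) * (2 * (M + 1))) * (e / (16 * (M + 1) * (M + 1)))"
            using M_nonneg d by (intro mult_mono) (auto simp: d_def)
          also have "\<dots> = e / 4"
            by (rule cancel2) (use M_nonneg in auto)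
          finally show ?thesis using 1 by simp
        qed
        finally show "norm (apply_bcontfun (b s' - b s) x) \<le> e / 2" by (simp add: b 1)
      qed
      then show ?thesis using e by simp
    qed
    with d show ?thesis by blast
  qed
  define k where "k s = S (b s)" for s
  have cont: "continuous_on UNIV (\<lambda>(t, s). apply_bcontfun (k s) t)"
    unfolding continuous_on_iff
  proof (intro ballI allI impI)
    fix z :: "real \<times> real" and e :: real assume e: "e > 0"
    obtain t s where z: "z = (t, s)" by (cases z)
    obtain d1 where d1: "d1 > 0" "\<And>s'. \<bar>s' - s\<bar> < d1 \<Longrightarrow> norm (b s' - b s) < c * (e / 2)"
      using b_cont[of "c * (e / 2)" s] e c(1) by auto
    have "continuous_on UNIV (apply_bcontfun (k s))" by simp
    then obtain d2 where d2: "d2 > 0" "\<And>t'. dist t' t < d2 \<Longrightarrow> dist (apply_bcontfun (k s) t') (apply_bcontfun (k s) t) < e / 2"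
      unfolding continuous_on_iff using e by (metis UNIV_I half_gt_zero)
    have "dist (apply_bcontfun (k s') t') (apply_bcontfun (k s) t) < e"
      if "dist (t', s') (t, s) < min d1 d2" for t' s'
    proof -
      have "dist t' t < d2" "\<bar>s' - s\<bar> < d1"
        using that dist_fst_le[of "(t', s')" "(t, s)"] dist_snd_le[of "(t', s')" "(t, s)"]
        by (auto simp: dist_real_def)
      have "c * norm (k s' - k s) < c * (e / 2)"
        unfolding k_def using S_lip[of "b s'" "b s"] d1(2)[OF \<open>\<bar>s' - s\<bar> < d1\<close>] by linarith
      then have "norm (k s' - k s) < e / 2" using c(1) mult_less_cancel_left_pos by blast
      then have "dist (apply_bcontfun (k s') t') (apply_bcontfun (k s) t') < e / 2"
        using dist_bounded[of "k s'" t' "k s"] by (simp add: dist_norm)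
      then show ?thesis
        using d2(2)[OF \<open>dist t' t < d2\<close>]
          dist_triangle[of "apply_bcontfun (k s') t'" "apply_bcontfun (k s) t" "apply_bcontfun (k s) t'"]
        by linarith
    qed
    then show "\<exists>d>0. \<forall>x'\<in>UNIV. dist x' z < d \<longrightarrow>
        dist (case x' of (t, s) \<Rightarrow> apply_bcontfun (k s) t) (case z of (t, s) \<Rightarrow> apply_bcontfun (k s) t) < e"
      using d1(1) d2(1) unfolding z by (intro exI[of _ "min d1 d2"]) auto
  qed
  show ?thesis
  proof (rule that[OF cont])
    fix s t
    have "conv r (\<lambda>u. K (u - s) - apply_bcontfun (k s) u) t = conv r (\<lambda>u. K (u - s)) t - conv r (apply_bcontfun (k s)) t"
      by (rule conv_diff[OF Km K_bound bcontfun_borel norm_bounded])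
    also have "\<dots> = apply_bcontfun (b s - conv_bc r (k s)) t"
      by (simp add: b apply_conv_bc[OF r])
    also have "b s - conv_bc r (k s) = k s" using S[of "b s"] by (simp add: k_def algebra_simps)
    finally show "K (t - s) - apply_bcontfun (k s) t + conv r (\<lambda>u. K (u - s) - apply_bcontfun (k s) u) t = K (t - s)"
      by simp
  qed
qed

end

section \<open>Step functions and the discretised operator\<close>

text \<open>The minimum puts the right endpoint \<open>N h\<close> into the last cell.\<close>

definition cell :: "nat \<Rightarrow> real \<Rightarrow> real \<Rightarrow> nat" where
  "cell N h t = min (nat \<lfloor>t / h\<rfloor>) (N - 1)"

lemma cell_measurable [measurable]: "cell N h \<in> borel \<rightarrow>\<^sub>M count_space UNIV"
proof -
  have "(\<lambda>t. \<lfloor>t / h\<rfloor>) \<in> borel \<rightarrow>\<^sub>M count_space UNIV" by measurable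
  from measurable_compose[OF this, of "\<lambda>i. min (nat i) (N - 1)"]
  show ?thesis unfolding cell_def[abs_def] by simp
qed

lemma step_measurable:
  fixes v :: "nat \<Rightarrow> 'b::topological_space"
  shows "(\<lambda>t. v (cell N h t)) \<in> borel_measurable borel"
  by (rule measurable_compose[OF cell_measurable]) simp

lemma cell_bounds:
  assumes "h > 0" "N \<ge> 1" "t \<in> {0..real N * h}"
  shows "cell N h t < N" "real (cell N h t) * h \<le> t" "t \<le> real (cell N h t) * h + h"
proof -
  have fl: "real_of_int \<lfloor>t / h\<rfloor> * h \<le> t" "t < real_of_int \<lfloor>t / h\<rfloor> * h + h" "0 \<le> \<lfloor>t / h\<rfloor>"
    using floor_divide_lower[of h t] floor_divide_upper[of h t] assms by (auto simp: algebra_simps)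
  show "cell N h t < N" using assms by (simp add: cell_def)
  have nat: "real (nat \<lfloor>t / h\<rfloor>) = real_of_int \<lfloor>t / h\<rfloor>" using fl by simp
  have "real (cell N h t) \<le> real_of_int \<lfloor>t / h\<rfloor>"
    unfolding nat[symmetric] by (simp add: cell_def)
  then have "real (cell N h t) * h \<le> real_of_int \<lfloor>t / h\<rfloor> * h"
    using assms(1) by (intro mult_right_mono) auto
  then show "real (cell N h t) * h \<le> t" using fl(1) by linarith
  show "t \<le> real (cell N h t) * h + h"
  proof (cases "nat \<lfloor>t / h\<rfloor> \<le> N - 1")
    case True
    then have "real (cell N h t) = real_of_int \<lfloor>t / h\<rfloor>" using nat by (simp add: cell_def)
    then show ?thesis using fl(2) by simp
  next
    case False
    then have "cell N h t = N - 1" by (simp add: cell_def)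
    then show ?thesis using assms by (simp add: of_nat_diff algebra_simps)
  qed
qed

lemma cell_eqI:
  assumes "h > 0" "l < N" "real l * h \<le> t" "t < real l * h + h"
  shows "cell N h t = l"
proof -
  have "\<lfloor>t / h\<rfloor> = int l"
    by (rule floor_unique) (use assms in \<open>auto simp: field_simps\<close>)
  then show ?thesis using assms(2) by (simp add: cell_def)
qed

lemma integral_step:
  fixes v :: "nat \<Rightarrow> complex"
  assumes h: "h > 0" and N: "N \<ge> 1"
  shows "(LINT t|lebesgue_on {0..real N * h}. v (cell N h t)) = of_real h * (\<Sum>l<N. v l)"
proof -
  have hi: "((\<lambda>t. v (cell N h t)) has_integral of_real h * (\<Sum>l<n. v l)) {0..real n * h}" if "n \<le> N" for n
    using that
  proof (induction n)
    case 0
    then show ?case by (simp add: has_integral_refl)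
  next
    case (Suc n)
    have "((\<lambda>t. v n) has_integral (real (Suc n) * h - real n * h) *\<^sub>R v n) {real n * h..real (Suc n) * h}"
      by (rule has_integral_const_real[THEN has_integral_eq_rhs]) (use h in \<open>simp add: content_real algebra_simps\<close>)
    \<comment> \<open>On the closed cell the step function can differ from \<open>v n\<close> only
      at the right endpoint, where the next cell begins.\<close>
    then have "((\<lambda>t. v (cell N h t)) has_integral (real (Suc n) * h - real n * h) *\<^sub>R v n)
        {real n * h..real (Suc n) * h}"
    proof (rule has_integral_spike_finite[where S = "{real (Suc n) * h}", rotated 2])
      show "v (cell N h x) = v n" if "x \<in> {real n * h..real (Suc n) * h} - {real (Suc n) * h}" for x
        using that Suc.prems h by (subst cell_eqI[of h n]) (auto simp: algebra_simps)
    qed simp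
    from has_integral_combine[OF _ _ Suc.IH this] Suc.prems h
    show ?case by (simp add: algebra_simps scaleR_conv_of_real)
  qed
  have b: "cmod (v (cell N h t)) \<le> (\<Sum>l<N. cmod (v l))" if "t \<in> {0..real N * h}" for t
    using cell_bounds(1)[OF h N that] by (intro member_le_sum) auto
  have "(LINT t|lebesgue_on {0..real N * h}. v (cell N h t)) = integral {0..real N * h} (\<lambda>t. v (cell N h t))"
    by (rule lebesgue_integral_eq_integral[OF integrable_bounded_interval[of "\<lambda>t. v (cell N h t)", OF step_measurable b]]) auto
  also have "\<dots> = of_real h * (\<Sum>l<N. v l)"
    using hi[of N] by (simp add: integral_unique)
  finally show ?thesis .
qed

context convolution
begin

text \<open>The off-diagonal part of the Toeplitz matrix of size \<open>N\<close>; its diagonal is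
  the identity, so \<open>v + dconv h N v\<close> is the matrix acting on \<open>v\<close>.\<close>

definition dconv :: "real \<Rightarrow> nat \<Rightarrow> (nat \<Rightarrow> complex) \<Rightarrow> nat \<Rightarrow> complex" where
  "dconv h N v k = (\<Sum>l<N. if l = k then 0 else of_real h * K ((real k - real l) * h) * v l)"

text \<open>The error is proportional to the bound \<open>C\<close> on \<open>v\<close>, which lets
  it be absorbed for vectors of unknown size.\<close>

lemma conv_step_close:
  assumes B: "0 \<le> B" and e: "e > 0"
  obtains h0 where "h0 > 0"
    "\<And>h N v C x. \<lbrakk>0 < h; h < h0; N \<ge> 1; real N * h \<le> B; \<And>l. l < N \<Longrightarrow> cmod (v l) \<le> C;
       x \<in> {0..real N * h}\<rbrakk> \<Longrightarrow>
       cmod (conv (real N * h) (\<lambda>t. v (cell N h t)) x - dconv h N v (cell N h x)) \<le> e * C"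
proof -
  define e' where "e' = e / (2 * (B + 1))"
  have e': "e' > 0" using e B by (simp add: e'_def)
  obtain d where d: "d > 0"
    "\<And>z w a. \<lbrakk>\<bar>z - w\<bar> \<le> a; a \<le> d\<rbrakk> \<Longrightarrow> cmod (K z - K w) \<le> e' + 2 * M * indicator {- a..a} z"
    using K_diff_peak[OF e'] by blast
  define h0 where "h0 = min d (e / (8 * (M + 1)))"
  have h0: "h0 > 0" using d e M_nonneg by (simp add: h0_def)
  show ?thesis
  proof (rule that[OF h0])
    fix h N v C x
    assume h: "0 < h" "h < h0" and N: "N \<ge> 1" "real N * h \<le> B"
      and v: "\<And>l. l < N \<Longrightarrow> cmod (v l) \<le> C" and x: "x \<in> {0..real N * h}"
    define r where "r = real N * h"
    have C: "0 \<le> C" using v[of 0] N by (auto intro: order_trans[OF norm_ge_zero])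
    note cx = cell_bounds[OF h(1) N(1) x]
    \<comment> \<open>The step kernel is \<open>0\<close> on the cell containing \<open>x\<close>,
      matching the omitted diagonal. That cell lies within \<open>h\<close> of \<open>x\<close>, so
      the omission is already covered by the peak term.\<close>
    define w where "w l = (if l = cell N h x then 0 else K ((real (cell N h x) - real l) * h))" for l
    have "cmod (conv r (\<lambda>t. v (cell N h t)) x - (LINT t|lebesgue_on {0..r}. w (cell N h t) * v (cell N h t)))
        \<le> (e' * r + 4 * M * h) * C"
    proof (rule norm_kernel_integral_diff[where y = x])
      show "(\<lambda>t. w (cell N h t)) \<in> borel_measurable borel" "(\<lambda>t. v (cell N h t)) \<in> borel_measurable borel"
        by (rule step_measurable)+
      fix t assume t: "t \<in> {0..r}"
      note ct = cell_bounds[OF h(1) N(1) t[unfolded r_def]]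
      show "cmod (v (cell N h t)) \<le> C" using v ct by blast
      have ind: "indicator {- h..h} (x - t) = (indicator {x - h..x + h} t :: real)"
        by (auto simp: indicator_def)
      show "cmod (K (x - t) - w (cell N h t)) \<le> e' + 2 * M * indicat_real {x - h..x + h} t"
      proof (cases "cell N h t = cell N h x")
        case True
        then have "t \<in> {x - h..x + h}" using cx ct by auto
        then show ?thesis using True K_bound[of "x - t"] M_nonneg e' by (simp add: w_def)
      next
        case False
        \<comment> \<open>Both \<open>x\<close> and \<open>t\<close> exceed the left endpoint of
          their cell by an amount between \<open>0\<close> and \<open>h\<close>.\<close>
        have "\<bar>(x - t) - (real (cell N h x) - real (cell N h t)) * h\<bar> \<le> h"
          using cx ct unfolding left_diff_distrib by linarith
        then show ?thesis using d(2)[of "x - t" _ h] h False by (simp add: w_def h0_def ind)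
      qed
    qed (use h N C e' in \<open>auto simp: r_def\<close>)
    also have "\<dots> \<le> e * C"
    proof (rule mult_right_mono[OF _ C])
      have "e' * r \<le> e' * (B + 1)" using N e' unfolding r_def by (intro mult_left_mono) auto
      also have "\<dots> = e / 2" using B by (simp add: e'_def field_simps)
      finally have 1: "e' * r \<le> e / 2" .
      have "4 * M * h \<le> 4 * (M + 1) * (e / (8 * (M + 1)))"
        using M_nonneg h by (intro mult_mono) (auto simp: h0_def)
      also have "\<dots> = e / 2" using M_nonneg by (simp add: field_simps)
      finally show "e' * r + 4 * M * h \<le> e" using 1 by simp
    qed
    also have "(LINT t|lebesgue_on {0..r}. w (cell N h t) * v (cell N h t)) = of_real h * (\<Sum>l<N. w l * v l)"
      unfolding r_def by (rule integral_step[OF h(1) N(1), of "\<lambda>l. w l * v l"])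
    also have "\<dots> = dconv h N v (cell N h x)"
      unfolding dconv_def sum_distrib_left by (rule sum.cong) (auto simp: w_def)
    finally show "cmod (conv (real N * h) (\<lambda>t. v (cell N h t)) x - dconv h N v (cell N h x)) \<le> e * C"
      by (simp add: r_def)
  qed
qed

text \<open>The bound for \<open>conv\<close> is applied to the step function of \<open>v\<close>.
  With \<open>C\<close> the maximal modulus of \<open>v\<close>, attained at \<open>m\<close>, the
  discretisation error is at most \<open>c / 2 * C\<close> and is absorbed by the left-hand side
  \<open>c * C\<close>, at the cost of half the constant.\<close>

lemma dconv_lower_bound:
  assumes B: "0 \<le> B"
  obtains c h0 where "c > 0" "h0 > 0"
    "\<And>h N s v e k. \<lbrakk>0 < h; h < h0; real N * h \<le> B; 0 \<le> s; s \<le> 1;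
       \<And>k. k < N \<Longrightarrow> cmod (v k + of_real s * dconv h N v k) \<le> e; k < N\<rbrakk> \<Longrightarrow> c * cmod (v k) \<le> e"
proof -
  obtain c where c: "c > 0"
    "\<And>r s f C e x. \<lbrakk>0 \<le> r; r \<le> B; 0 \<le> s; s \<le> 1; f \<in> borel_measurable borel;
      \<And>t. t \<in> {0..r} \<Longrightarrow> cmod (f t) \<le> C;
      \<And>t. t \<in> {0..r} \<Longrightarrow> cmod (f t + of_real s * conv r f t) \<le> e; x \<in> {0..r}\<rbrakk> \<Longrightarrow> c * cmod (f x) \<le> e"
    using conv_lower_bound[OF B] by metis
  have c2: "c / 2 > 0" using c by simp
  obtain h0 where h0: "h0 > 0"
    "\<And>h N v C x. \<lbrakk>0 < h; h < h0; N \<ge> 1; real N * h \<le> B; \<And>l. l < N \<Longrightarrow> cmod (v l) \<le> C;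
       x \<in> {0..real N * h}\<rbrakk> \<Longrightarrow>
       cmod (conv (real N * h) (\<lambda>t. v (cell N h t)) x - dconv h N v (cell N h x)) \<le> c / 2 * C"
    using conv_step_close[OF B c2] by metis
  show ?thesis
  proof (rule that[OF c2 h0(1)])
    fix h N s v e k
    assume h: "0 < h" "h < h0" and Nh: "real N * h \<le> B" and s: "0 \<le> s" "s \<le> 1"
      and ve: "\<And>k. k < N \<Longrightarrow> cmod (v k + of_real s * dconv h N v k) \<le> e" and k: "k < N"
    have N: "N \<ge> 1" using k by simp
    define C where "C = Max ((\<lambda>l. cmod (v l)) ` {..<N})"
    have vC: "cmod (v l) \<le> C" if "l < N" for l unfolding C_def using that by (intro Max_ge) auto
    have "C \<in> (\<lambda>l. cmod (v l)) ` {..<N}" unfolding C_def using k by (intro Max_in) auto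
    then obtain m where m: "m < N" "C = cmod (v m)" by auto
    define f where "f t = v (cell N h t)" for t
    have "c * cmod (f (real m * h)) \<le> e + c / 2 * C"
    proof (rule c(2)[of "real N * h" s f C])
      fix t assume t: "t \<in> {0..real N * h}"
      note ct = cell_bounds[OF h(1) N t]
      show "cmod (f t) \<le> C" unfolding f_def using vC ct by blast
      define z where "z = conv (real N * h) f t - dconv h N v (cell N h t)"
      have z: "cmod z \<le> c / 2 * C" using h0(2)[OF h N Nh, of v C t] vC t by (simp add: z_def f_def[abs_def])
      have "cmod (of_real s * z) \<le> 1 * (c / 2 * C)"
        unfolding norm_mult using s z by (intro mult_mono) auto
      then have sz: "cmod (of_real s * z) \<le> c / 2 * C" by simp
      have "f t + of_real s * conv (real N * h) f t
          = (v (cell N h t) + of_real s * dconv h N v (cell N h t)) + of_real s * z"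
        by (simp add: f_def z_def algebra_simps)
      then show "cmod (f t + of_real s * conv (real N * h) f t) \<le> e + c / 2 * C"
        using norm_triangle_mono[OF ve[OF ct(1)] sz] by simp
    qed (use h Nh s m in \<open>auto simp: f_def[abs_def] step_measurable\<close>)
    moreover have "f (real m * h) = v m"
      unfolding f_def by (subst cell_eqI[of h m]) (use h m in auto)
    ultimately have "c / 2 * C \<le> e" using m by simp
    then show "c / 2 * cmod (v k) \<le> e"
      using mult_left_mono[OF vC[OF k], of "c / 2"] c(1) by linarith
  qed
qed

text \<open>The step function of the first \<open>N\<close> unknowns nearly solves the equation of
  \<open>g\<close> on \<open>[0, N * h]\<close>. Three errors arise: the discretisation, the last
  unknown \<open>v N\<close>, whose cell lies outside that interval, and the right-hand side,
  shifted by at most \<open>2 * h\<close>. The lower bound for \<open>conv\<close> converts the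
  residual into a bound at \<open>0\<close>.\<close>

lemma discrete_resolvent_close:
  assumes B: "0 \<le> B" and e: "e > 0"
  obtains h0 where "h0 > 0"
    "\<And>h N v g D. \<lbrakk>0 < h; h < h0; N \<ge> 1; real (Suc N) * h \<le> B;
       \<And>k. k \<le> N \<Longrightarrow> v k + dconv h (Suc N) v k = K ((real k - real (Suc N)) * h);
       g \<in> borel_measurable borel; \<And>t. t \<in> {0..real N * h} \<Longrightarrow> cmod (g t) \<le> D;
       \<And>x. x \<in> {0..real N * h} \<Longrightarrow> g x + conv (real N * h) g x = K (x - real N * h)\<rbrakk>
     \<Longrightarrow> cmod (g 0 - v 0) \<le> e"
proof -
  obtain c where c: "c > 0"
    "\<And>r s f C e x. \<lbrakk>0 \<le> r; r \<le> B; 0 \<le> s; s \<le> 1; f \<in> borel_measurable borel;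
      \<And>t. t \<in> {0..r} \<Longrightarrow> cmod (f t) \<le> C;
      \<And>t. t \<in> {0..r} \<Longrightarrow> cmod (f t + of_real s * conv r f t) \<le> e; x \<in> {0..r}\<rbrakk> \<Longrightarrow> c * cmod (f x) \<le> e"
    using conv_lower_bound[OF B] by metis
  obtain c1 h1 where c1: "c1 > 0" "h1 > 0"
    "\<And>h N s v e k. \<lbrakk>0 < h; h < h1; real N * h \<le> B; 0 \<le> s; s \<le> 1;
       \<And>k. k < N \<Longrightarrow> cmod (v k + of_real s * dconv h N v k) \<le> e; k < N\<rbrakk> \<Longrightarrow> c1 * cmod (v k) \<le> e"
    using dconv_lower_bound[OF B] by metis
  \<comment> \<open>A bound for \<open>v\<close> that is uniform in \<open>h\<close> and
    \<open>N\<close>, since the right-hand side of its system is at most \<open>M\<close>.\<close>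
  define V where "V = M / c1"
  have V: "V \<ge> 0" using c1 M_nonneg by (simp add: V_def)
  \<comment> \<open>One third of \<open>c * e\<close> for each of the three errors.\<close>
  define q where "q = c * e / 3"
  have q: "q > 0" using c e by (simp add: q_def)
  have qV: "q / (V + 1) > 0" using q V by simp
  obtain h2 where h2: "h2 > 0"
    "\<And>h N v C x. \<lbrakk>0 < h; h < h2; N \<ge> 1; real N * h \<le> B; \<And>l. l < N \<Longrightarrow> cmod (v l) \<le> C;
       x \<in> {0..real N * h}\<rbrakk> \<Longrightarrow>
       cmod (conv (real N * h) (\<lambda>t. v (cell N h t)) x - dconv h N v (cell N h x)) \<le> q / (V + 1) * C"
    using conv_step_close[OF B qV] by metis
  obtain d where d: "d > 0"
    "\<And>z w. \<lbrakk>\<bar>z - w\<bar> \<le> d; \<bar>z - w\<bar> < \<bar>z\<bar> \<or> z \<le> 0 \<and> w \<le> 0\<rbrakk> \<Longrightarrow> cmod (K z - K w) \<le> q"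
    using K_modulus[OF q] by blast
  define h0 where "h0 = Min {h1, h2, d / 2, q / (M * V + 1)}"
  have "h0 > 0" using c1 h2 d q M_nonneg V by (auto simp: h0_def intro!: divide_pos_pos add_nonneg_pos)
  then show ?thesis
  proof (rule that)
    fix h N v g D
    assume h: "0 < h" "h < h0" and N: "N \<ge> 1" and Nh: "real (Suc N) * h \<le> B"
      and v: "\<And>k. k \<le> N \<Longrightarrow> v k + dconv h (Suc N) v k = K ((real k - real (Suc N)) * h)"
      and g: "g \<in> borel_measurable borel" "\<And>t. t \<in> {0..real N * h} \<Longrightarrow> cmod (g t) \<le> D"
      and geq: "\<And>x. x \<in> {0..real N * h} \<Longrightarrow> g x + conv (real N * h) g x = K (x - real N * h)"
    have "0 < M * V + 1" using M_nonneg V by (simp add: add_nonneg_pos)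
    moreover have "h < q / (M * V + 1)" using h by (simp add: h0_def)
    ultimately have "h * (M * V + 1) \<le> q" by (simp only: pos_less_divide_eq less_imp_le)
    moreover have "h < h1" "h < h2" "2 * h \<le> d" using h by (auto simp: h0_def)
    ultimately have hs: "h < h1" "h < h2" "2 * h \<le> d" "h * (M * V + 1) \<le> q" by auto
    have NB: "real N * h \<le> B" using Nh h by (simp add: algebra_simps)
    have vV: "cmod (v k) \<le> V" if "k \<le> N" for k
    proof -
      have "c1 * cmod (v k) \<le> M"
        by (rule c1(3)[OF h(1) hs(1) Nh, of 1]) (use v K_bound that in auto)
      then show ?thesis using c1(1) by (simp add: V_def field_simps)
    qed
    define f where "f t = v (cell N h t)" for t
    have fm: "f \<in> borel_measurable borel" unfolding f_def[abs_def] by (rule step_measurable)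
    have fb: "cmod (f t) \<le> V" if "t \<in> {0..real N * h}" for t
      unfolding f_def using vV cell_bounds(1)[OF h(1) N that] by simp
    have "c * cmod (f 0 - g 0) \<le> 3 * q"
    proof (rule c(2)[of "real N * h" 1 "\<lambda>t. f t - g t" "V + D"])
      fix x assume x: "x \<in> {0..real N * h}"
      note cx = cell_bounds[OF h(1) N x]
      show "cmod (f x - g x) \<le> V + D"
        using fb[OF x] g(2)[OF x] norm_triangle_ineq4[of "f x" "g x"] by linarith
      define k where "k = cell N h x"
      have k: "k < N" using cx by (simp add: k_def)
      have 1: "cmod (conv (real N * h) f x - dconv h N v k) \<le> q"
      proof -
        have "cmod (conv (real N * h) f x - dconv h N v k) \<le> q / (V + 1) * V"
          using h2(2)[OF h(1) hs(2) N NB _ x, of v V] vV by (simp add: f_def[abs_def] k_def)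
        also have "\<dots> \<le> q" using q V by (simp add: field_simps)
        finally show ?thesis .
      qed
      have 2: "cmod (of_real h * K ((real k - real N) * h) * v N) \<le> q"
      proof -
        have "cmod (of_real h * K ((real k - real N) * h) * v N) \<le> h * M * V"
          unfolding norm_mult using h K_bound vV[of N] M_nonneg by (intro mult_mono) auto
        also have "\<dots> \<le> q" using hs(4) h by (simp add: algebra_simps)
        finally show ?thesis .
      qed
      have 3: "cmod (K (x - real N * h) - K ((real k - real (Suc N)) * h)) \<le> q"
      proof (rule d(2))
        show "\<bar>x - real N * h - (real k - real (Suc N)) * h\<bar> \<le> d"
          using cx hs(3) h(1) by (simp add: k_def algebra_simps)
        \<comment> \<open>Both arguments of \<open>K\<close> are nonpositive, so the jump is not
          crossed even at \<open>x = real N * h\<close>, where the argument is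
          \<open>0\<close>.\<close>
        have "(real k - real (Suc N)) * h \<le> 0"
          using k h by (intro mult_nonpos_nonneg) auto
        then show "\<bar>x - real N * h - (real k - real (Suc N)) * h\<bar> < \<bar>x - real N * h\<bar>
            \<or> x - real N * h \<le> 0 \<and> (real k - real (Suc N)) * h \<le> 0"
          using x by auto
      qed
      have "dconv h (Suc N) v k = dconv h N v k + of_real h * K ((real k - real N) * h) * v N"
        using k by (simp add: dconv_def)
      then have vk: "v k + dconv h N v k = K ((real k - real (Suc N)) * h) - of_real h * K ((real k - real N) * h) * v N"
        using v[of k] k by (simp add: algebra_simps)
      have "f x - g x + of_real 1 * conv (real N * h) (\<lambda>t. f t - g t) x
          = (f x + conv (real N * h) f x) - (g x + conv (real N * h) g x)"
        using conv_diff[OF fm fb g] by simp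
      also have "\<dots> = (conv (real N * h) f x - dconv h N v k)
          - of_real h * K ((real k - real N) * h) * v N
          - (K (x - real N * h) - K ((real k - real (Suc N)) * h))"
        using vk geq[OF x] by (simp add: f_def k_def algebra_simps)
      finally show "cmod (f x - g x + of_real 1 * conv (real N * h) (\<lambda>t. f t - g t) x) \<le> 3 * q"
        using 1 2 3 norm_triangle_ineq4 by (smt (verit))
    qed (use h NB fm g in auto)
    moreover have "f 0 = v 0" unfolding f_def by (subst cell_eqI[of h 0]) (use h N in auto)
    ultimately show "cmod (g 0 - v 0) \<le> e"
      using c(1) by (simp add: q_def norm_minus_commute)
  qed
qed

end

section \<open>Positivity of Hermitian forms\<close>

lemma quadratic_nonneg_imp_linear_zero:
  fixes a b :: real
  assumes "\<And>t. 0 \<le> a * t + b * t\<^sup>2"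
  shows "a = 0"
proof (rule ccontr)
  assume a: "a \<noteq> 0"
  \<comment> \<open>Enlarging \<open>b\<close> to a positive \<open>B\<close> keeps the inequality
    and avoids a case distinction on the sign of \<open>b\<close>; the point
    \<open>- a / (2 * B)\<close> minimises the enlarged quadratic.\<close>
  define B where "B = \<bar>b\<bar> + 1"
  have B: "b \<le> B" "0 < B" by (auto simp: B_def)
  have "0 \<le> a * (- a / (2 * B)) + b * (- a / (2 * B))\<^sup>2" by (rule assms)
  also have "\<dots> \<le> a * (- a / (2 * B)) + B * (- a / (2 * B))\<^sup>2"
    using B by (intro add_left_mono mult_right_mono) auto
  also have "\<dots> = - (a\<^sup>2 / (4 * B))"
    using B by (simp add: power2_eq_square field_simps)
  also have "\<dots> < 0" using a B by simp
  finally show False by simp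
qed

text \<open>Vectors of length \<open>N\<close> are functions vanishing from \<open>N\<close> on. The
  sphere is then a closed subset of a product of compact discs and singletons, compact by
  Tychonoff.\<close>

lemma compact_unit_sphere_prefix:
  "compact {v :: nat \<Rightarrow> complex. (\<Sum>k<N. (cmod (v k))\<^sup>2) = 1 \<and> (\<forall>k\<ge>N. v k = 0)}" (is "compact ?S")
proof -
  let ?B = "\<lambda>k. if k < N then cball 0 1 else {0 :: complex}"
  have "compactin (product_topology (\<lambda>_. euclidean) UNIV) (PiE UNIV ?B)"
    by (subst compactin_PiE) auto
  then have "compact (PiE UNIV ?B)"
    by (simp add: euclidean_product_topology)
  moreover have "closed {v :: nat \<Rightarrow> complex. (\<Sum>k<N. (cmod (v k))\<^sup>2) = 1}"
    by (intro closed_Collect_eq continuous_intros continuous_on_product_coordinates)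
  ultimately have "compact (PiE UNIV ?B \<inter> {v. (\<Sum>k<N. (cmod (v k))\<^sup>2) = 1})"
    by (rule compact_Int_closed)
  moreover have "cmod (v k) \<le> 1" if "(\<Sum>k<N. (cmod (v k))\<^sup>2) = 1" "k < N" for v :: "nat \<Rightarrow> complex" and k
  proof -
    have "(cmod (v k))\<^sup>2 \<le> (\<Sum>k<N. (cmod (v k))\<^sup>2)" using that(2) by (intro member_le_sum) auto
    then show ?thesis using that(1) by (simp add: power2_le_imp_le abs_square_le_1)
  qed
  then have "?S = PiE UNIV ?B \<inter> {v. (\<Sum>k<N. (cmod (v k))\<^sup>2) = 1}"
    by (auto simp: PiE_UNIV_domain Pi_def split: if_splits)
  ultimately show ?thesis by simp
qed

text \<open>A minimiser of the Rayleigh quotient is an eigenvector, and the injectivity hypothesis with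
  \<open>s = 1 / (1 - m)\<close> excludes the eigenvalue \<open>m \<le> 0\<close>.\<close>

lemma hermitian_form_pos:
  fixes A :: "nat \<Rightarrow> nat \<Rightarrow> complex"
  assumes herm: "\<And>k l. k < N \<Longrightarrow> l < N \<Longrightarrow> A l k = cnj (A k l)"
    and inj: "\<And>s v k. \<lbrakk>0 \<le> s; s \<le> 1;
        \<And>k. k < N \<Longrightarrow> of_real (1 - s) * v k + of_real s * (\<Sum>l<N. A k l * v l) = 0; k < N\<rbrakk> \<Longrightarrow> v k = 0"
    and v: "k0 < N" "v k0 \<noteq> 0"
  shows "0 < Re (\<Sum>k<N. (\<Sum>l<N. A k l * v l) * cnj (v k))"
proof (rule ccontr)
  define q where "q w = Re (\<Sum>k<N. (\<Sum>l<N. A k l * w l) * cnj (w k))" for w :: "nat \<Rightarrow> complex"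
  define n2 where "n2 w = (\<Sum>k<N. (cmod (w k))\<^sup>2)" for w :: "nat \<Rightarrow> complex"
  define S where "S = {w :: nat \<Rightarrow> complex. n2 w = 1 \<and> (\<forall>k\<ge>N. w k = 0)}"
  assume "\<not> 0 < Re (\<Sum>k<N. (\<Sum>l<N. A k l * v l) * cnj (v k))"
  then have qv: "q v \<le> 0" by (simp add: q_def)
  have n2_nonneg: "0 \<le> n2 w" for w unfolding n2_def by (intro sum_nonneg) auto
  have n2_pos: "0 < n2 w" if "k < N" "w k \<noteq> 0" for w k
    unfolding n2_def by (rule sum_pos2[of _ k]) (use that in auto)
  have q_scale: "q (\<lambda>k. of_real a * w k) = a\<^sup>2 * q w" for a w
  proof -
    have "(\<Sum>k<N. (\<Sum>l<N. A k l * (of_real a * w l)) * cnj (of_real a * w k))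
        = of_real (a\<^sup>2) * (\<Sum>k<N. (\<Sum>l<N. A k l * w l) * cnj (w k))"
      unfolding sum_distrib_left sum_distrib_right
      by (intro sum.cong refl) (simp add: power2_eq_square mult_ac)
    moreover have "Re (of_real c * z) = c * Re z" for c z by simp
    ultimately show ?thesis by (simp only: q_def)
  qed
  have normalise: "\<exists>u\<in>S. q w = n2 w * q u" if "0 < n2 w" for w
  proof -
    define a where "a = 1 / sqrt (n2 w)"
    have a2: "a\<^sup>2 = 1 / n2 w" using that by (simp add: a_def power_divide)
    define u where "u k = (if k < N then of_real a * w k else 0)" for k
    have "n2 u = a\<^sup>2 * n2 w"
      unfolding n2_def sum_distrib_left by (intro sum.cong) (auto simp: u_def norm_mult power_mult_distrib)
    then have "u \<in> S" using a2 that by (simp add: S_def u_def)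
    moreover have "q u = q (\<lambda>k. of_real a * w k)"
      unfolding q_def by (intro arg_cong[where f = Re] sum.cong refl arg_cong2[where f = times]) (auto simp: u_def)
    ultimately show ?thesis using q_scale a2 that by (intro bexI[of _ u]) auto
  qed
  have "continuous_on S q" unfolding q_def
    by (intro continuous_intros continuous_on_subset[OF continuous_on_product_coordinates subset_UNIV])
  moreover have "compact S" unfolding S_def n2_def by (rule compact_unit_sphere_prefix)
  moreover obtain u0 where u0: "u0 \<in> S" "q v = n2 v * q u0" using normalise[OF n2_pos[of k0 v, OF v]] by blast
  ultimately obtain u where u: "u \<in> S" "\<And>w. w \<in> S \<Longrightarrow> q u \<le> q w"
    using continuous_attains_inf[of S q] by blast
  define m where "m = q u"
  have "q u0 \<le> 0" using u0(2) qv n2_pos[of k0 v, OF v] by (simp add: mult_le_0_iff)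
  then have m: "m \<le> 0" using u(2)[OF u0(1)] by (simp add: m_def)
  have ray: "m * n2 w \<le> q w" for w
  proof (cases "n2 w = 0")
    case True
    then have "w k = 0" if "k < N" for k using n2_pos[of k w] that by force
    then have "q w = 0" by (simp add: q_def)
    then show ?thesis using True by simp
  next
    case False
    then have "0 < n2 w" using n2_nonneg[of w] by simp
    then show ?thesis using normalise[of w] u(2) by (force simp: m_def mult.commute)
  qed
  \<comment> \<open>\<open>D\<close> is the matrix minus \<open>m\<close> times the identity. Its
    form is nonnegative by \<open>ray\<close> and vanishes at the minimiser
    \<open>u\<close>.\<close>
  define D where "D k l = A k l - (if k = l then of_real m else 0)" for k l
  define b where "b w z = (\<Sum>k<N. (\<Sum>l<N. D k l * w l) * cnj (z k))" for w z
  have Dsum: "(\<Sum>l<N. D k l * w l) = (\<Sum>l<N. A k l * w l) - of_real m * w k" if "k < N" for k w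
  proof -
    have "(\<Sum>l<N. D k l * w l) = (\<Sum>l<N. A k l * w l - (if k = l then of_real m * w l else 0))"
      by (intro sum.cong) (auto simp: D_def algebra_simps)
    then show ?thesis using that by (simp add: sum_subtractf)
  qed
  have b_self: "Re (b w w) = q w - m * n2 w" for w
  proof -
    have "b w w = (\<Sum>k<N. (\<Sum>l<N. A k l * w l) * cnj (w k) - of_real (m * (cmod (w k))\<^sup>2))"
      unfolding b_def
      by (intro sum.cong refl) (simp add: Dsum left_diff_distrib mult.assoc flip: complex_norm_square)
    then show ?thesis by (simp add: q_def n2_def sum_subtractf sum_distrib_left)
  qed
  have b_sym: "b w z = cnj (b z w)" for w z
  proof -
    have "cnj (b z w) = (\<Sum>k<N. \<Sum>l<N. cnj (D k l) * cnj (z l) * w k)"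
      by (simp add: b_def sum_distrib_right)
    also have "\<dots> = (\<Sum>l<N. \<Sum>k<N. cnj (D k l) * cnj (z l) * w k)" by (rule sum.swap)
    also have "\<dots> = b w z"
      unfolding b_def sum_distrib_right
      by (intro sum.cong refl) (simp add: D_def herm[symmetric])
    finally show ?thesis by simp
  qed
  \<comment> \<open>Moving \<open>u\<close> in the direction \<open>y = D u\<close> makes the linear
    coefficient of the nonnegative quadratic equal to \<open>2 * n2 y\<close>, so
    \<open>D u = 0\<close>.\<close>
  define y where "y k = (\<Sum>l<N. D k l * u l)" for k
  have exp: "Re (b (\<lambda>k. u k + of_real t * y k) (\<lambda>k. u k + of_real t * y k))
      = Re (b u u) + 2 * Re (b u y) * t + Re (b y y) * t\<^sup>2" for t
  proof -
    have "b (\<lambda>k. u k + of_real t * y k) (\<lambda>k. u k + of_real t * y k)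
        = b u u + of_real t * b u y + of_real t * b y u + of_real (t\<^sup>2) * b y y"
      unfolding b_def sum_distrib_left sum_distrib_right sum.distrib[symmetric]
      by (intro sum.cong refl) (simp add: power2_eq_square algebra_simps)
    moreover have "Re (b y u) = Re (b u y)" using b_sym[of y u] by simp
    ultimately show ?thesis by (simp add: power2_eq_square)
  qed
  have "n2 u = 1" using u(1) by (simp add: S_def)
  then have "Re (b u u) = 0" by (simp add: b_self m_def)
  then have "0 \<le> 2 * Re (b u y) * t + Re (b y y) * t\<^sup>2" for t
    using exp[of t] b_self ray by (metis add_0 diff_ge_0_iff_ge)
  then have "Re (b u y) = 0" using quadratic_nonneg_imp_linear_zero[of "2 * Re (b u y)" "Re (b y y)"] by simp
  moreover have "Re (b u y) = n2 y"
  proof -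
    have "b u y = (\<Sum>k<N. of_real ((cmod (y k))\<^sup>2))"
      unfolding b_def by (intro sum.cong) (simp_all add: y_def[symmetric] flip: complex_norm_square)
    then show ?thesis by (simp add: n2_def)
  qed
  ultimately have y0: "y k = 0" if "k < N" for k using n2_pos[of k y] that by force
  \<comment> \<open>Chosen so that \<open>1 - s + s * m = 0\<close>; it lies in
    \<open>[0, 1]\<close> because \<open>m \<le> 0\<close>.\<close>
  define s where "s = 1 / (1 - m)"
  have s: "0 \<le> s" "s \<le> 1" using m by (auto simp: s_def)
  have sm: "1 - s + s * m = 0" using m by (simp add: s_def field_simps)
  have "u k = 0" if "k < N" for k
  proof (rule inj[OF s _ that])
    fix k assume "k < N"
    then have "(\<Sum>l<N. A k l * u l) = of_real m * u k" using y0[of k] Dsum[of k u] by (simp add: y_def)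
    then have "of_real (1 - s) * u k + of_real s * (\<Sum>l<N. A k l * u l) = of_real (1 - s + s * m) * u k"
      by (simp add: algebra_simps)
    then show "of_real (1 - s) * u k + of_real s * (\<Sum>l<N. A k l * u l) = 0" using sm by simp
  qed
  then have "n2 u = 0" by (simp add: n2_def)
  then show False using \<open>n2 u = 1\<close> by simp
qed

section \<open>Toeplitz matrices and Verblunsky coefficients\<close>

lemma toeplitz_carrier: "toeplitz_mat H h j \<in> carrier_mat (Suc j) (Suc j)"
  by (simp add: toeplitz_mat_def)

lemma toeplitz_index:
  assumes "k \<le> j" "l \<le> j"
  shows "toeplitz_mat H h j $$ (k, l) = (if k = l then 1 else of_real h * H ((real k - real l) * h))"
  using assms by (simp add: toeplitz_mat_def)

lemma toeplitz_hermitian: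
  assumes "hermitian_fun H" "h \<noteq> 0" "k \<le> j" "l \<le> j"
  shows "toeplitz_mat H h j $$ (l, k) = cnj (toeplitz_mat H h j $$ (k, l))"
proof (cases "k = l")
  case False
  then have "(real k - real l) * h \<noteq> 0" using assms by simp
  moreover have "(real l - real k) * h = - ((real k - real l) * h)" by (simp add: algebra_simps)
  ultimately have "H ((real l - real k) * h) = cnj (H ((real k - real l) * h))"
    using assms(1) unfolding hermitian_fun_def by metis
  then show ?thesis using False assms by (simp add: toeplitz_index)
qed (use assms in \<open>simp add: toeplitz_index\<close>)

lemma pos_def_mat_toeplitzI:
  assumes H: "hermitian_fun H" "h \<noteq> 0"
    and inj: "\<And>s v k. \<lbrakk>0 \<le> s; s \<le> 1;
        \<And>k. k \<le> j \<Longrightarrow> of_real (1 - s) * v k + of_real s * (\<Sum>l\<le>j. toeplitz_mat H h j $$ (k, l) * v l) = 0; k \<le> j\<rbrakk>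
      \<Longrightarrow> v k = (0 :: complex)"
  shows "pos_def_mat (toeplitz_mat H h j)"
  unfolding pos_def_mat_def
proof (intro conjI ballI impI)
  let ?T = "toeplitz_mat H h j"
  show "square_mat ?T" by (simp add: toeplitz_mat_def)
  fix v :: "complex vec"
  assume "v \<in> carrier_vec (dim_row ?T)" and "v \<noteq> 0\<^sub>v (dim_row ?T)"
  then have dv: "dim_vec v = Suc j" and v0: "v \<noteq> 0\<^sub>v (Suc j)" by (auto simp: toeplitz_mat_def)
  obtain k0 where k0: "k0 < Suc j" "v $ k0 \<noteq> 0"
    using v0 dv by (metis eq_vecI index_zero_vec)
  define Q where "Q = (\<Sum>k<Suc j. (\<Sum>l<Suc j. ?T $$ (k, l) * v $ l) * cnj (v $ k))"
  have eq: "(?T *\<^sub>v v) \<bullet>c v = Q"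
    unfolding Q_def scalar_prod_def using dv toeplitz_carrier[of H h j]
    by (auto simp: scalar_prod_def lessThan_atLeast0 intro!: sum.cong)
  have "0 < Re Q"
    unfolding Q_def
  proof (rule hermitian_form_pos[where A = "\<lambda>k l. ?T $$ (k, l)" and v = "\<lambda>k. v $ k" and ?k0.0 = k0, OF _ _ k0])
    show "?T $$ (l, k) = cnj (?T $$ (k, l))" if "k < Suc j" "l < Suc j" for k l
      using that by (intro toeplitz_hermitian H) auto
    show "v k = 0" if "0 \<le> s" "s \<le> 1"
        "\<And>k. k < Suc j \<Longrightarrow> of_real (1 - s) * v k + of_real s * (\<Sum>l<Suc j. ?T $$ (k, l) * v l) = 0"
        "k < Suc j" for s v k
      using that by (intro inj[of s v]) (auto simp: lessThan_Suc_atMost)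
  qed
  \<comment> \<open>Positivity in the order on complex numbers also demands a vanishing imaginary
    part.\<close>
  moreover have "cnj Q = Q"
  proof -
    have "cnj Q = (\<Sum>k<Suc j. \<Sum>l<Suc j. cnj (?T $$ (k, l)) * cnj (v $ l) * v $ k)"
      by (simp only: Q_def sum_distrib_right cnj_sum complex_cnj_mult complex_cnj_cnj)
    also have "\<dots> = (\<Sum>l<Suc j. \<Sum>k<Suc j. cnj (?T $$ (k, l)) * cnj (v $ l) * v $ k)" by (rule sum.swap)
    also have "\<dots> = Q"
      unfolding Q_def sum_distrib_right
      by (intro sum.cong refl) (simp add: toeplitz_hermitian[OF H, symmetric])
    finally show ?thesis .
  qed
  ultimately show "0 < (?T *\<^sub>v v) \<bullet>c v"
    unfolding eq by (simp add: less_complex_def complex_eq_iff)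
qed

lemma pos_def_mat_det_nonzero:
  assumes "pos_def_mat A" "A \<in> carrier_mat n n"
  shows "Determinant.det A \<noteq> 0"
proof
  assume "Determinant.det A = 0"
  then obtain v where v: "v \<in> carrier_vec n" "v \<noteq> 0\<^sub>v n" "A *\<^sub>v v = 0\<^sub>v n"
    using det_0_iff_vec_prod_zero[OF assms(2)] by auto
  then have "0 < (A *\<^sub>v v) \<bullet>c v" using assms by (auto simp: pos_def_mat_def)
  then show False using v by simp
qed

text \<open>Cramer's rule for the inverse; at the entry \<open>(0, 0)\<close> it will produce the
  determinant ratio of consecutive Toeplitz sections.\<close>

lemma mat_inverse_index:
  assumes A: "(A :: 'a::field mat) \<in> carrier_mat n n" and d: "Determinant.det A \<noteq> 0"
    and ij: "i < n" "j < n"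
  shows "the (mat_inverse A) $$ (i, j) = cofactor A j i / Determinant.det A"
    and "A * the (mat_inverse A) = 1\<^sub>m n" and "the (mat_inverse A) \<in> carrier_mat n n"
proof -
  define C where "C = the (mat_inverse A)"
  have "A \<in> Units (ring_mat TYPE('a) n ())"
    by (rule det_non_zero_imp_unit[OF A d])
  then have "mat_inverse A = Some C"
    using mat_inverse(1)[OF A, where b = "()"] by (cases "mat_inverse A") (auto simp: C_def)
  then have C: "A * C = 1\<^sub>m n" "C \<in> carrier_mat n n" using mat_inverse(2)[OF A] by auto
  then show "A * the (mat_inverse A) = 1\<^sub>m n" "the (mat_inverse A) \<in> carrier_mat n n" by (auto simp: C_def)
  have "adj_mat A = adj_mat A * (A * C)" using C adj_mat[OF A] by simp
  also have "\<dots> = (adj_mat A * A) * C" using A C adj_mat(1)[OF A] by simp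
  also have "\<dots> = Determinant.det A \<cdot>\<^sub>m C" using adj_mat(3)[OF A] C mult_smult_assoc_mat[of "1\<^sub>m n" n n C n "Determinant.det A"] by simp
  finally have "adj_mat A $$ (i, j) = Determinant.det A * C $$ (i, j)" using C ij by simp
  moreover have "adj_mat A $$ (i, j) = cofactor A j i" using A ij by (simp add: adj_mat_def)
  ultimately show "the (mat_inverse A) $$ (i, j) = cofactor A j i / Determinant.det A"
    using d by (simp add: C_def field_simps)
qed

text \<open>The first column of the inverse, normalised to start with \<open>1\<close>, is reversed and conjugated:
  by persymmetry this solves the system whose right-hand side is a column of the matrix.\<close>

lemma verblunsky_eq_solution:
  assumes H: "hermitian_fun H" and h: "h \<noteq> 0"
    and pd: "pos_def_mat (toeplitz_mat H h j)" "pos_def_mat (toeplitz_mat H h (Suc j))"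
  obtains g where "verblunsky H h j = of_real h * g 0"
    "\<And>k. k \<le> j \<Longrightarrow> g k + (\<Sum>l\<le>j. if l = k then 0 else of_real h * H ((real k - real l) * h) * g l)
        = H ((real k - real (Suc j)) * h)"
proof -
  define A where "A = toeplitz_mat H h (Suc j)"
  define n where "n = Suc j"
  have A: "A \<in> carrier_mat (Suc n) (Suc n)" unfolding A_def n_def by (rule toeplitz_carrier)
  have dA: "Determinant.det A \<noteq> 0"
    using pos_def_mat_det_nonzero[OF pd(2)] toeplitz_carrier A_def by blast
  have dT: "Determinant.det (toeplitz_mat H h j) \<noteq> 0"
    using pos_def_mat_det_nonzero[OF pd(1)] toeplitz_carrier by blast
  define C where "C = the (mat_inverse A)"
  have C: "A * C = 1\<^sub>m (Suc n)" "C \<in> carrier_mat (Suc n) (Suc n)"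
    unfolding C_def using mat_inverse_index(2,3)[OF A dA, of 0 0] by auto
  have "mat_delete A 0 0 = toeplitz_mat H h j"
  proof (rule eq_matI)
    fix k l assume "k < dim_row (toeplitz_mat H h j)" "l < dim_col (toeplitz_mat H h j)"
    then have "k \<le> j" "l \<le> j" by (auto simp: toeplitz_mat_def)
    then show "mat_delete A 0 0 $$ (k, l) = toeplitz_mat H h j $$ (k, l)"
      unfolding A_def by (auto simp: mat_delete_def toeplitz_mat_def)
  qed (auto simp: A_def mat_delete_def toeplitz_mat_def)
  \<comment> \<open>The determinant ratio in \<open>verblunsky\<close> is the reciprocal of this
    entry, so the coefficient is \<open>- cnj (x n)\<close> for the normalised column
    \<open>x\<close>.\<close>
  then have C00: "C $$ (0, 0) = Determinant.det (toeplitz_mat H h j) / Determinant.det A"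
    unfolding C_def by (subst mat_inverse_index(1)[OF A dA]) (auto simp: cofactor_def)
  define x where "x k = C $$ (k, 0) / C $$ (0, 0)" for k
  have x0: "x 0 = 1" using C00 dA dT by (simp add: x_def)
  \<comment> \<open>Row \<open>0\<close> is left out, being the only one where the product with the
    first column is nonzero. After reversal it becomes row \<open>n\<close>, which leaves exactly
    the \<open>j + 1\<close> equations wanted.\<close>
  have Ax: "(\<Sum>l\<le>n. A $$ (k, l) * x l) = 0" if k: "k \<le> n" "k \<noteq> 0" for k
  proof -
    have "(A * C) $$ (k, 0) = (\<Sum>l\<le>n. A $$ (k, l) * C $$ (l, 0))"
      using A C(2) k by (simp add: scalar_prod_def atLeast0LessThan lessThan_Suc_atMost)
    moreover have "(A * C) $$ (k, 0) = 0" using C k by simp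
    ultimately show ?thesis by (simp add: x_def flip: sum_divide_distrib)
  qed
  define y where "y k = cnj (x (n - k))" for k
  have Ay: "(\<Sum>l\<le>n. A $$ (k, l) * y l) = 0" if k: "k < n" for k
  proof -
    \<comment> \<open>Entries depend on the index difference only, so reversing both indices
      transposes the matrix; Hermitian symmetry turns this into conjugation.\<close>
    have sym: "A $$ (k, l) = cnj (A $$ (n - k, n - l))" if l: "l \<le> n" for l
    proof -
      have "A $$ (n - k, n - l) = A $$ (l, k)"
        using k l by (auto simp: A_def n_def[symmetric] toeplitz_index of_nat_diff)
      then show ?thesis
        using toeplitz_hermitian[OF H h, of l n k] k l by (simp add: A_def n_def)
    qed
    have "(\<Sum>l\<le>n. A $$ (k, l) * y l) = (\<Sum>l\<le>n. cnj (A $$ (n - k, n - l) * x (n - l)))"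
      by (intro sum.cong) (auto simp: sym y_def)
    also have "\<dots> = (\<Sum>l\<le>n. cnj (A $$ (n - k, l) * x l))"
      by (rule sum.reindex_bij_witness[where i = "\<lambda>l. n - l" and j = "\<lambda>l. n - l"]) auto
    also have "\<dots> = cnj (\<Sum>l\<le>n. A $$ (n - k, l) * x l)" by simp
    also have "\<dots> = 0" using Ax[of "n - k"] k by simp
    finally show ?thesis .
  qed
  \<comment> \<open>Since \<open>y n = 1\<close>, the last column moves to the right-hand side;
    dividing by \<open>- h\<close> removes the factor \<open>h\<close> from its entries.\<close>
  define g where "g k = - y k / of_real h" for k
  show ?thesis
  proof (rule that[of g])
    have "verblunsky H h j = - cnj (x n)"
      unfolding verblunsky_def Suc_eq_plus1[symmetric] A_def[symmetric] C_def[symmetric]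
      using C00 dA dT by (simp add: x_def n_def)
    then show "verblunsky H h j = of_real h * g 0" using h by (simp add: g_def y_def)
    fix k assume k: "k \<le> j"
    have yn: "y n = 1" by (simp add: y_def x0)
    have "0 = (\<Sum>l\<le>j. A $$ (k, l) * y l) + A $$ (k, n) * y n"
      using Ay[of k] k by (simp add: n_def)
    also have "A $$ (k, n) = of_real h * H ((real k - real (Suc j)) * h)"
      using k by (simp add: A_def n_def toeplitz_index)
    also have "(\<Sum>l\<le>j. A $$ (k, l) * y l)
        = (\<Sum>l\<le>j. (if l = k then y k else 0) + (if l = k then 0 else of_real h * H ((real k - real l) * h) * y l))"
      by (intro sum.cong) (use k in \<open>auto simp: A_def toeplitz_index\<close>)
    also have "\<dots> = y k + (\<Sum>l\<le>j. if l = k then 0 else of_real h * H ((real k - real l) * h) * y l)"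
      using k by (simp add: sum.distrib)
    finally have yk: "y k + (\<Sum>l\<le>j. if l = k then 0 else of_real h * H ((real k - real l) * h) * y l)
        = - (of_real h * H ((real k - real (Suc j)) * h))"
      by (simp add: yn add_eq_0_iff)
    have "(\<Sum>l\<le>j. if l = k then 0 else of_real h * H ((real k - real l) * h) * g l)
        = - (\<Sum>l\<le>j. if l = k then 0 else of_real h * H ((real k - real l) * h) * y l) / of_real h"
      unfolding sum_divide_distrib sum_negf[symmetric]
      by (intro sum.cong) (auto simp: g_def)
    then have "g k + (\<Sum>l\<le>j. if l = k then 0 else of_real h * H ((real k - real l) * h) * g l)
        = - (y k + (\<Sum>l\<le>j. if l = k then 0 else of_real h * H ((real k - real l) * h) * y l)) / of_real h"
      by (simp only: g_def minus_add_distrib add_divide_distrib)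
    then show "g k + (\<Sum>l\<le>j. if l = k then 0 else of_real h * H ((real k - real l) * h) * g l)
        = H ((real k - real (Suc j)) * h)"
      unfolding yk using h by simp
  qed
qed

section \<open>From the accelerant to the convolution operator\<close>

text \<open>Lets \<open>H\<close> be exchanged for \<open>K\<close> at the jump, and a chosen
  resolvent kernel for its continuous extension. Measurability of \<open>g\<close> is deduced from
  that of \<open>f\<close>, since nothing is known about the values at the exceptional
  points.\<close>

lemma integral_cong_off_finite:
  fixes f g :: "real \<Rightarrow> complex"
  assumes f: "f \<in> borel_measurable borel" and S: "finite S"
    and eq: "\<And>t. t \<in> {0..r} - S \<Longrightarrow> g t = f t"
  shows "(LINT t|lebesgue_on {0..r}. g t) = (LINT t|lebesgue_on {0..r}. f t)"
proof -
  have AE: "AE t in lebesgue_on {0..r}. t \<notin> S"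
  proof -
    have "AE t in lebesgue_on {0..r}. \<forall>c\<in>S. t \<noteq> c"
      by (rule AE_finite_allI[OF S]) (rule AE_lebesgue_on_neq)
    then show ?thesis by eventually_elim auto
  qed
  have fm: "f \<in> borel_measurable (lebesgue_on {0..r})"
    by (rule borel_measurable_lebesgue_on_borel[OF f])
  have gm: "g \<in> borel_measurable (lebesgue_on {0..r})"
    by (rule measurable_discrete_difference[OF fm, of "S \<inter> {0..r}"]) (use S eq in \<open>auto simp: countable_finite sets_restrict_space_iff\<close>)
  have "AE t in lebesgue_on {0..r}. g t = f t"
    using AE AE_space by eventually_elim (use eq in auto)
  then show ?thesis by (rule integral_cong_AE[OF gm fm])
qed

lemma continuous_AE_zero_imp_zero:
  fixes f :: "real \<Rightarrow> complex"
  assumes f: "continuous_on UNIV f" and ae: "AE x in lebesgue_on {0..r}. f x = 0"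
    and r: "0 < r" and y: "y \<in> {0..r}"
  shows "f y = 0"
proof -
  let ?q = "\<lambda>x. (cmod (f x))\<^sup>2"
  have qc: "continuous_on {0..r} ?q" by (intro continuous_intros continuous_on_subset[OF f]) auto
  have "(LINT x|lebesgue_on {0..r}. ?q x) = 0"
    by (rule integral_eq_zero_AE) (use ae in eventually_elim, simp)
  moreover have "integrable (lebesgue_on {0..r}) ?q"
    using qc by (intro continuous_imp_integrable_real)
  ultimately have "(?q has_integral 0) {0..r}"
    using has_integral_integral_lebesgue_on[of "{0..r}" ?q] by simp
  then have "?q y = 0"
    using has_integral_0_cbox_imp_0[of 0 r ?q y] qc r y by (simp add: box_real)
  then show ?thesis by simp
qed

text \<open>From \<open>s * conv_op H r f = - f\<close> one gets
  \<open>s * (f + conv_op H r f) = - (1 - s) * f\<close>. Pairing with \<open>f\<close> makes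
  \<open>s\<close> times the positive form equal to \<open>- (1 - s)\<close> times the squared norm,
  which is impossible for \<open>s > 0\<close> unless \<open>f\<close> vanishes.\<close>

lemma accelerant_injective:
  fixes f :: "real \<Rightarrow> complex"
  assumes acc: "accelerant H" and r: "0 < r" and s: "0 \<le> s" "s \<le> 1" and f: "continuous_on UNIV f"
    and eq: "\<And>x. x \<in> {0..r} \<Longrightarrow> f x + of_real s * conv_op H r f x = 0"
    and y: "y \<in> {0..r}"
  shows "f y = 0"
proof (cases "s = 0")
  case True
  then show ?thesis using eq[OF y] by simp
next
  case False
  with s have s0: "0 < s" by simp
  show ?thesis
  proof (rule ccontr)
    assume "f y \<noteq> 0"
    then have nz: "\<not> (AE x in lebesgue_on {0..r}. f x = 0)"
      using continuous_AE_zero_imp_zero[OF f _ r y] by blast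
    have fm: "f \<in> borel_measurable borel" by (rule borel_measurable_continuous_onI[OF f])
    have q: "integrable (lebesgue_on {0..r}) (\<lambda>x. (cmod (f x))\<^sup>2)"
      by (intro continuous_imp_integrable_real continuous_intros continuous_on_subset[OF f]) auto
    have "f \<in> L2_on r"
      using q borel_measurable_lebesgue_on_borel[OF fm] by (simp add: L2_on_def)
    define Q where "Q = (LINT x|lebesgue_on {0..r}. (f x + conv_op H r f x) * cnj (f x))"
    define E where "E = (LINT x|lebesgue_on {0..r}. (cmod (f x))\<^sup>2)"
    have "0 < Q" unfolding Q_def using acc r nz \<open>f \<in> L2_on r\<close> unfolding accelerant_def by blast
    then have Q: "0 < Re Q" by (simp add: less_complex_def)
    have E: "0 \<le> E" unfolding E_def by simp
    have "of_real s * Q = (LINT x|lebesgue_on {0..r}. of_real s * ((f x + conv_op H r f x) * cnj (f x)))"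
      unfolding Q_def by simp
    also have "\<dots> = (LINT x|lebesgue_on {0..r}. of_real (- (1 - s)) * of_real ((cmod (f x))\<^sup>2))"
    proof (rule Bochner_Integration.integral_cong[OF refl])
      fix x assume "x \<in> space (lebesgue_on {0..r})"
      then have "of_real s * conv_op H r f x = - f x" using eq[of x] by (simp add: add_eq_0_iff)
      then have "of_real s * (f x + conv_op H r f x) = of_real (- (1 - s)) * f x"
        by (simp add: distrib_left left_diff_distrib)
      then have "of_real s * ((f x + conv_op H r f x) * cnj (f x)) = of_real (- (1 - s)) * (f x * cnj (f x))"
        by (metis mult.assoc)
      then show "of_real s * ((f x + conv_op H r f x) * cnj (f x)) = of_real (- (1 - s)) * of_real ((cmod (f x))\<^sup>2)"
        by (simp only: complex_norm_square)
    qed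
    also have "\<dots> = of_real (- (1 - s) * E)"
      unfolding E_def by (simp only: integral_mult_right_zero integral_complex_of_real of_real_mult)
    finally have "Re (of_real s * Q) = - (1 - s) * E" by simp
    then have "s * Re Q = - (1 - s) * E" by simp
    moreover have "0 < s * Re Q" using s0 Q by simp
    moreover have "0 \<le> (1 - s) * E" using s E by simp
    ultimately show False by (simp add: algebra_simps)
  qed
qed

lemma convolution_of_accelerant:
  assumes H: "hermitian_fun H" "continuous_half_line H" "accelerant H" and B: "0 < B"
  obtains p M where "convolution p M B"
    "\<And>x. x \<noteq> 0 \<Longrightarrow> \<bar>x\<bar> \<le> B \<Longrightarrow> jump_kernel p x = H x"
proof -
  obtain L where L: "(H \<longlongrightarrow> L) (at_right 0)" and Hc: "continuous_on {0<..} H"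
    using H(2) by (auto simp: continuous_half_line_def)
  define u where "u x = (if x \<le> 0 then L else H x)" for x
  have uc: "continuous_on {0<..} u"
    using Hc by (rule continuous_on_eq) (simp add: u_def)
  have ucB: "continuous_on {0..B} u"
    unfolding continuous_on_eq_continuous_within
  proof
    fix x assume x: "x \<in> {0..B}"
    show "continuous (at x within {0..B}) u"
    proof (cases "x = 0")
      case True
      have "\<forall>\<^sub>F y in at_right 0. u y = H y"
        by (auto simp: u_def eventually_at_filter)
      then have "(u \<longlongrightarrow> L) (at_right 0)" using L tendsto_cong by metis
      then show ?thesis using True B by (simp add: continuous_within at_within_Icc_at_right u_def)
    next
      case False
      then have "isCont u x" using uc x by (simp add: continuous_on_eq_continuous_at)
      then show ?thesis by (rule continuous_at_imp_continuous_at_within)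
    qed
  qed
  \<comment> \<open>Clamping makes \<open>p\<close> constant outside \<open>[0, B]\<close>, hence
    uniformly continuous and bounded on the whole line; for the operators with
    \<open>r \<le> B\<close> only arguments of modulus at most \<open>B\<close> matter.\<close>
  define p where "p x = u (max 0 (min x B))" for x
  have p_unif: "uniformly_continuous_on UNIV p"
    unfolding uniformly_continuous_on_def
  proof (intro allI impI)
    fix e :: real assume "e > 0"
    moreover have "uniformly_continuous_on {0..B} u"
      by (rule compact_uniformly_continuous[OF ucB]) simp
    ultimately obtain d where d: "d > 0"
      "\<And>x y. x \<in> {0..B} \<Longrightarrow> y \<in> {0..B} \<Longrightarrow> dist y x < d \<Longrightarrow> dist (u y) (u x) < e"
      unfolding uniformly_continuous_on_def by metis
    have "dist (p y) (p x) < e" if "dist y x < d" for x y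
      unfolding p_def
    proof (rule d(2))
      have "\<bar>max 0 (min y B) - max 0 (min x B)\<bar> \<le> \<bar>y - x\<bar>" by linarith
      then show "dist (max 0 (min y B)) (max 0 (min x B)) < d" using that by (simp add: dist_real_def)
    qed (use B in auto)
    with d(1) show "\<exists>d>0. \<forall>x\<in>UNIV. \<forall>x'\<in>UNIV. dist x' x < d \<longrightarrow> dist (p x') (p x) < e" by blast
  qed
  have "bounded (u ` {0..B})" by (intro compact_imp_bounded compact_continuous_image ucB) simp
  then obtain M where M: "\<And>x. x \<in> {0..B} \<Longrightarrow> cmod (u x) \<le> M"
    unfolding bounded_iff by blast
  have pb: "cmod (p x) \<le> M" for x unfolding p_def by (rule M) (use B in auto)
  have KH: "jump_kernel p x = H x" if "x \<noteq> 0" "\<bar>x\<bar> \<le> B" for x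
  proof (cases "x > 0")
    case True
    then show ?thesis using that by (simp add: jump_kernel_def p_def u_def)
  next
    case False
    then have "jump_kernel p x = cnj (H (- x))" using that by (simp add: jump_kernel_def p_def u_def)
    then show ?thesis using H(1) that(1) by (simp add: hermitian_fun_def)
  qed
  have Km: "jump_kernel p \<in> borel_measurable borel"
  proof -
    have [measurable]: "p \<in> borel_measurable borel"
      by (rule borel_measurable_continuous_onI[OF uniformly_continuous_imp_continuous[OF p_unif]])
    have [measurable]: "cnj \<in> borel_measurable borel"
      by (intro borel_measurable_continuous_onI continuous_intros)
    show ?thesis unfolding jump_kernel_def[abs_def] by measurable
  qed
  have "convolution p M B"
  proof
    show "uniformly_continuous_on UNIV p" "\<And>x. cmod (p x) \<le> M" by (fact p_unif pb)+
    fix r s f y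
    assume r: "0 < r" "r \<le> B" and s: "0 \<le> s" "s \<le> (1::real)" and f: "continuous_on UNIV f"
      and eq: "\<And>x. x \<in> {0..r} \<Longrightarrow>
          f x + of_real s * (LINT t|lebesgue_on {0..r}. jump_kernel p (x - t) * f t) = 0"
      and y: "y \<in> {0..r}"
    note [measurable] = Km borel_measurable_continuous_onI[OF f]
    show "f y = 0"
    proof (rule accelerant_injective[OF H(3) r(1) s f _ y])
      fix x assume x: "x \<in> {0..r}"
      have "conv_op H r f x = (LINT t|lebesgue_on {0..r}. jump_kernel p (x - t) * f t)"
        unfolding conv_op_def
        by (rule integral_cong_off_finite[of _ "{x}"]) (use x r in \<open>auto intro!: KH[symmetric]\<close>)
      then show "f x + of_real s * conv_op H r f x = 0" using eq[OF x] by simp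
    qed
  qed
  then show ?thesis using KH by (rule that)
qed

section \<open>Krein coefficients and their approximation\<close>

context convolution
begin

text \<open>Existence of a resolvent kernel makes the one selected by \<open>SOME\<close> satisfy
  the defining properties, and the column is extracted from these.\<close>

lemma krein_coeff_column:
  assumes KH: "\<And>x. x \<noteq> 0 \<Longrightarrow> \<bar>x\<bar> \<le> B \<Longrightarrow> K x = H x" and r: "0 < r" "r \<le> B"
  obtains g D where "g \<in> borel_measurable borel" "\<And>t. t \<in> {0..r} \<Longrightarrow> cmod (g t) \<le> D"
    "\<And>x. x \<in> {0..r} \<Longrightarrow> g x + conv r g x = K (x - r)" "g 0 = krein_coeff H r"
proof -
  obtain k where k: "continuous_on UNIV (\<lambda>(t, s). k s t)"
    "\<And>s t. K (t - s) - k s t + conv r (\<lambda>u. K (u - s) - k s u) t = K (t - s)"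
    using exists_resolvent_kernel[of r] r by auto
  have "is_resolvent_kernel H r (\<lambda>t s. K (t - s) - k s t)"
    unfolding is_resolvent_kernel_def
  proof (intro conjI ballI impI)
    fix t s assume t: "t \<in> {0..r}" and s: "s \<in> {0..r}" and ts: "t \<noteq> s"
    have "continuous_on UNIV (\<lambda>t. (t, s))" by (intro continuous_intros)
    from continuous_on_compose2[OF k(1) this] have "continuous_on UNIV (k s)" by simp
    then have [measurable]: "k s \<in> borel_measurable borel" by (rule borel_measurable_continuous_onI)
    have "(LINT u|lebesgue_on {0..r}. H (t - u) * (K (u - s) - k s u)) = conv r (\<lambda>u. K (u - s) - k s u) t"
      unfolding conv_def
      by (rule integral_cong_off_finite[of _ "{t}"]) (use t r in \<open>auto intro!: KH[symmetric]\<close>)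
    then show "K (t - s) - k s t + (LINT u|lebesgue_on {0..r}. H (t - u) * (K (u - s) - k s u)) = H (t - s)"
      using k(2) KH[of "t - s"] t s ts r by auto
  next
    have "continuous_on UNIV (\<lambda>z :: real \<times> real. cnj (p (snd z - fst z)) - (case z of (t, s) \<Rightarrow> k s t))"
      by (intro continuous_intros continuous_on_compose2[OF p_continuous] k(1)) auto
    then show "\<exists>U. continuous_on {(t, s). 0 \<le> t \<and> t \<le> s \<and> s \<le> r} (\<lambda>(t, s). U t s) \<and>
        (\<forall>t s. 0 \<le> t \<and> t < s \<and> s \<le> r \<longrightarrow> K (t - s) - k s t = U t s)"
      by (intro exI[of _ "\<lambda>t s. cnj (p (s - t)) - k s t"] conjI)
        (auto simp: jump_kernel_def case_prod_unfold intro: continuous_on_subset)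
    have "continuous_on UNIV (\<lambda>z :: real \<times> real. p (fst z - snd z) - (case z of (t, s) \<Rightarrow> k s t))"
      by (intro continuous_intros continuous_on_compose2[OF p_continuous] k(1)) auto
    then show "\<exists>L. continuous_on {(t, s). 0 \<le> s \<and> s \<le> t \<and> t \<le> r} (\<lambda>(t, s). L t s) \<and>
        (\<forall>t s. 0 \<le> s \<and> s < t \<and> t \<le> r \<longrightarrow> K (t - s) - k s t = L t s)"
      by (intro exI[of _ "\<lambda>t s. p (t - s) - k s t"] conjI)
        (auto simp: jump_kernel_def case_prod_unfold intro: continuous_on_subset)
  qed
  then have "is_resolvent_kernel H r (resolvent_kernel H r)"
    unfolding resolvent_kernel_def by (rule someI[where P = "is_resolvent_kernel H r"])
  note G = this[unfolded is_resolvent_kernel_def]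
  have Geq: "\<And>t s. \<lbrakk>t \<in> {0..r}; s \<in> {0..r}; t \<noteq> s\<rbrakk> \<Longrightarrow> resolvent_kernel H r t s
        + (LINT u|lebesgue_on {0..r}. H (t - u) * resolvent_kernel H r u s) = H (t - s)"
    using conjunct1[OF G] by blast
  obtain U where Uc: "continuous_on {(t, s). 0 \<le> t \<and> t \<le> s \<and> s \<le> r} (\<lambda>(t, s). U t s)"
    and GU: "\<And>t s. 0 \<le> t \<and> t < s \<and> s \<le> r \<Longrightarrow> resolvent_kernel H r t s = U t s"
    using conjunct1[OF conjunct2[OF G]] by blast
  \<comment> \<open>The selected kernel is controlled only off the diagonal, so on the column
    \<open>s = r\<close> its values for \<open>t < r\<close> are replaced by the continuous
    extension from the triangle \<open>t \<le> s\<close>.\<close>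
  define w where "w t = U (max 0 (min t r)) r" for t
  have "continuous_on UNIV (\<lambda>t. (max 0 (min t r), r))" by (intro continuous_intros)
  then have "continuous_on UNIV (\<lambda>t. case (max 0 (min t r), r) of (t, s) \<Rightarrow> U t s)"
    by (rule continuous_on_compose2[OF Uc]) (use r in auto)
  then have wc: "continuous_on UNIV w" by (simp add: w_def[abs_def])
  have wm [measurable]: "w \<in> borel_measurable borel" by (rule borel_measurable_continuous_onI[OF wc])
  have "bounded (w ` {0..r})"
    by (intro compact_imp_bounded compact_continuous_image continuous_on_subset[OF wc]) auto
  then obtain D where D: "\<And>t. t \<in> {0..r} \<Longrightarrow> cmod (w t) \<le> D"
    unfolding bounded_iff by blast
  \<comment> \<open>Defined by the right-hand side of the equation, \<open>g\<close> satisfies it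
    also at \<open>t = r\<close>, where the selected kernel may have any value.\<close>
  define g where "g t = K (t - r) - conv r w t" for t
  have "continuous_on UNIV (conv r w)" using conv_continuous[OF _ r(2) wm D] r by simp
  then have [measurable]: "conv r w \<in> borel_measurable borel" by (rule borel_measurable_continuous_onI)
  have gm [measurable]: "g \<in> borel_measurable borel" unfolding g_def[abs_def] by measurable
  have wG: "w t = resolvent_kernel H r t r" if "t \<in> {0..<r}" for t
    using that GU[of t r] by (simp add: w_def)
  have gG: "g t = resolvent_kernel H r t r" if t: "t \<in> {0..<r}" for t
  proof -
    have "(LINT u|lebesgue_on {0..r}. H (t - u) * resolvent_kernel H r u r) = conv r w t"
      unfolding conv_def
      by (rule integral_cong_off_finite[of _ "{t, r}"]) (use t r wG KH[symmetric] in auto)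
    moreover have "K (t - r) = H (t - r)" using t r by (intro KH) auto
    ultimately show ?thesis using Geq[of t r] t by (simp add: g_def algebra_simps)
  qed
  have "conv r g x = conv r w x" for x
    unfolding conv_def
    by (rule integral_cong_off_finite[of _ "{r}"]) (auto simp: gG wG)
  then have "g x + conv r g x = K (x - r)" for x by (simp add: g_def)
  moreover have "cmod (g t) \<le> M + M * D * r" for t
  proof -
    have "cmod (conv r w t) \<le> M * D * r" by (rule conv_bound[OF wm D]) (use r in auto)
    then show ?thesis
      unfolding g_def using norm_triangle_ineq4[of "K (t - r)" "conv r w t"] K_bound[of "t - r"]
      by linarith
  qed
  moreover have "g 0 = krein_coeff H r" using gG[of 0] r by (simp add: krein_coeff_def)
  ultimately show ?thesis using gm by (intro that)
qed

lemma toeplitz_sum_eq_dconv: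
  assumes KH: "\<And>x. x \<noteq> 0 \<Longrightarrow> \<bar>x\<bar> \<le> B \<Longrightarrow> K x = H x"
    and h: "0 < h" "real j * h \<le> B" and k: "k \<le> j"
  shows "(\<Sum>l\<le>j. if l = k then 0 else of_real h * H ((real k - real l) * h) * v l) = dconv h (Suc j) v k"
proof -
  have "H ((real k - real l) * h) = K ((real k - real l) * h)" if "l \<le> j" "l \<noteq> k" for l
  proof (rule KH[symmetric])
    have "\<bar>real k - real l\<bar> \<le> real j" using k that by auto
    from mult_right_mono[OF this, of h] have "\<bar>real k - real l\<bar> * h \<le> B" using h by linarith
    then show "\<bar>(real k - real l) * h\<bar> \<le> B" using h by (simp add: abs_mult)
  qed (use that h in auto)
  then show ?thesis
    unfolding dconv_def lessThan_Suc_atMost by (intro sum.cong) auto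
qed

text \<open>The unit diagonal turns \<open>(1 - s) * v + s * T v\<close> into
  \<open>v + s * dconv v\<close>, so the discrete lower bound with residual \<open>0\<close>
  supplies the injectivity that positivity requires. A matrix of size \<open>j + 1\<close> occupies
  \<open>j + 1\<close> cells, whence the size condition.\<close>

lemma toeplitz_pos_def:
  assumes B: "0 < B" and H: "hermitian_fun H"
    and KH: "\<And>x. x \<noteq> 0 \<Longrightarrow> \<bar>x\<bar> \<le> B \<Longrightarrow> K x = H x"
  obtains h0 where "h0 > 0"
    "\<And>h j. \<lbrakk>0 < h; h < h0; real (Suc j) * h \<le> B\<rbrakk> \<Longrightarrow> pos_def_mat (toeplitz_mat H h j)"
proof -
  obtain c h0 where c: "c > 0" "h0 > 0"
    "\<And>h N s v e k. \<lbrakk>0 < h; h < h0; real N * h \<le> B; 0 \<le> s; s \<le> 1;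
       \<And>k. k < N \<Longrightarrow> cmod (v k + of_real s * dconv h N v k) \<le> e; k < N\<rbrakk> \<Longrightarrow> c * cmod (v k) \<le> e"
    using dconv_lower_bound[OF less_imp_le[OF B]] by metis
  show ?thesis
  proof (rule that[OF c(2)])
    fix h j assume h: "0 < h" "h < h0" and jB: "real (Suc j) * h \<le> B"
    show "pos_def_mat (toeplitz_mat H h j)"
    proof (rule pos_def_mat_toeplitzI[OF H])
      fix s v k
      assume s: "0 \<le> s" "s \<le> (1::real)" and k: "k \<le> j"
        and eq: "\<And>k. k \<le> j \<Longrightarrow> of_real (1 - s) * v k + of_real s * (\<Sum>l\<le>j. toeplitz_mat H h j $$ (k, l) * v l) = 0"
      have "v k + of_real s * dconv h (Suc j) v k = 0" if "k \<le> j" for k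
      proof -
        have "(\<Sum>l\<le>j. toeplitz_mat H h j $$ (k, l) * v l)
            = (\<Sum>l\<le>j. (if l = k then v k else 0) + (if l = k then 0 else of_real h * H ((real k - real l) * h) * v l))"
          by (intro sum.cong) (use that in \<open>auto simp: toeplitz_index\<close>)
        also have "\<dots> = v k + (\<Sum>l\<le>j. if l = k then 0 else of_real h * H ((real k - real l) * h) * v l)"
          using that by (simp add: sum.distrib)
        also have "\<dots> = v k + dconv h (Suc j) v k"
          using toeplitz_sum_eq_dconv[OF KH h(1) _ that, of v] jB h by (simp add: algebra_simps)
        finally show ?thesis using eq[OF that] by (simp add: algebra_simps)
      qed
      then have "c * cmod (v k) \<le> 0"
        by (intro c(3)[OF h jB s]) (use k in auto)
      then show "v k = 0" using c(1) by (simp add: mult_le_0_iff)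
    qed (use h in auto)
  qed
qed

text \<open>The condition on \<open>j + 2\<close> reflects that \<open>verblunsky H h j\<close> uses
  the section of that size, which must be positive definite; \<open>j \<ge> 1\<close> makes
  \<open>[0, j * h]\<close> nondegenerate.\<close>

lemma verblunsky_close:
  assumes B: "0 < B" and H: "hermitian_fun H"
    and KH: "\<And>x. x \<noteq> 0 \<Longrightarrow> \<bar>x\<bar> \<le> B \<Longrightarrow> K x = H x" and e: "e > 0"
  obtains h0 where "h0 > 0"
    "\<And>h j. \<lbrakk>0 < h; h < h0; j \<ge> 1; real (j + 2) * h \<le> B\<rbrakk> \<Longrightarrow>
       cmod (krein_coeff H (real j * h) - verblunsky H h j / of_real h) \<le> e"
proof -
  obtain h1 where h1: "h1 > 0"
    "\<And>h j. \<lbrakk>0 < h; h < h1; real (Suc j) * h \<le> B\<rbrakk> \<Longrightarrow> pos_def_mat (toeplitz_mat H h j)"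
    using toeplitz_pos_def[OF B H KH] by blast
  obtain h2 where h2: "h2 > 0"
    "\<And>h N v g D. \<lbrakk>0 < h; h < h2; N \<ge> 1; real (Suc N) * h \<le> B;
       \<And>k. k \<le> N \<Longrightarrow> v k + dconv h (Suc N) v k = K ((real k - real (Suc N)) * h);
       g \<in> borel_measurable borel; \<And>t. t \<in> {0..real N * h} \<Longrightarrow> cmod (g t) \<le> D;
       \<And>x. x \<in> {0..real N * h} \<Longrightarrow> g x + conv (real N * h) g x = K (x - real N * h)\<rbrakk>
     \<Longrightarrow> cmod (g 0 - v 0) \<le> e"
    using discrete_resolvent_close[OF less_imp_le[OF B] e] by metis
  show ?thesis
  proof (rule that[of "min h1 h2"])
    fix h j assume h: "0 < h" "h < min h1 h2" and j: "j \<ge> 1" and jB: "real (j + 2) * h \<le> B"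
    have jB': "real (Suc (Suc j)) * h \<le> B" "real (Suc j) * h \<le> B" "real j * h \<le> B"
      using jB h by (auto simp: algebra_simps)
    obtain v where v: "verblunsky H h j = of_real h * v 0"
      "\<And>k. k \<le> j \<Longrightarrow> v k + (\<Sum>l\<le>j. if l = k then 0 else of_real h * H ((real k - real l) * h) * v l)
          = H ((real k - real (Suc j)) * h)"
      using verblunsky_eq_solution[OF H, of h j] h1(2)[OF h(1) _ jB'(2)] h1(2)[OF h(1) _ jB'(1)] h by auto
    obtain g D where g: "g \<in> borel_measurable borel" "\<And>t. t \<in> {0..real j * h} \<Longrightarrow> cmod (g t) \<le> D"
      "\<And>x. x \<in> {0..real j * h} \<Longrightarrow> g x + conv (real j * h) g x = K (x - real j * h)"
      "g 0 = krein_coeff H (real j * h)"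
      using krein_coeff_column[OF KH _ jB'(3)] h j by auto
    have "cmod (g 0 - v 0) \<le> e"
    proof (rule h2(2)[OF h(1) _ j jB'(2) _ g(1-3)])
      fix k assume k: "k \<le> j"
      have "K ((real k - real (Suc j)) * h) = H ((real k - real (Suc j)) * h)"
      proof (rule KH)
        have "\<bar>real k - real (Suc j)\<bar> \<le> real (Suc j)" using k by auto
        from mult_right_mono[OF this, of h] have "\<bar>real k - real (Suc j)\<bar> * h \<le> B"
          using h jB'(2) by linarith
        then show "\<bar>(real k - real (Suc j)) * h\<bar> \<le> B" using h by (simp add: abs_mult)
      qed (use k h in auto)
      then show "v k + dconv h (Suc j) v k = K ((real k - real (Suc j)) * h)"
        using v(2)[OF k] toeplitz_sum_eq_dconv[OF KH h(1) jB'(3) k, of v] by simp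
    qed (use h in auto)
    then show "cmod (krein_coeff H (real j * h) - verblunsky H h j / of_real h) \<le> e"
      using v(1) g(4) h by simp
  qed (use h1 h2 in auto)
qed

end

theorem theorem9p3:
  fixes H :: "real \<Rightarrow> complex" and R :: real
  assumes "hermitian_fun H"
    and "continuous_half_line H"
    and "accelerant H"
    and "R > 0"
  shows "(\<forall>\<^sub>F n :: nat in sequentially. pos_def_mat (toeplitz_mat H (R / real n) n)) \<and>
    (\<forall>\<delta>. 0 < \<delta> \<and> \<delta> < R \<longrightarrow>
      (\<lambda>n :: nat. SUP j \<in> {j :: nat. \<delta> < real j * (R / real n) \<and> real j * (R / real n) < R}.
         cmod (krein_coeff H (real j * (R / real n))
               - verblunsky H (R / real n) j / of_real (R / real n))) \<longlonglongrightarrow> 0)"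
proof -
  \<comment> \<open>The matrix of size \<open>n + 1\<close> needs an interval of length
    \<open>R + R / n\<close>, which exceeds \<open>R\<close> but not \<open>2 * R\<close>.\<close>
  have B: "0 < 2 * R" using assms(4) by simp
  obtain p M where conv: "convolution p M (2 * R)"
    and KH: "\<And>x. x \<noteq> 0 \<Longrightarrow> \<bar>x\<bar> \<le> 2 * R \<Longrightarrow> jump_kernel p x = H x"
    using convolution_of_accelerant[OF assms(1-3) B] by blast
  interpret convolution p M "2 * R" by fact
  have hlim: "(\<lambda>n. R / real n) \<longlonglongrightarrow> 0" by (rule lim_const_over_n)
  have small: "\<forall>\<^sub>F n in sequentially. 0 < R / real n \<and> R / real n < h0 \<and> 1 \<le> n" if "h0 > 0" for h0
    using order_tendstoD(2)[OF hlim that] eventually_ge_at_top[of 1]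
    by eventually_elim (use assms(4) in auto)
  have size: "real m * (R / real n) \<le> 2 * R" if "m \<le> n + 1" "1 \<le> n" for m n
  proof -
    have "real m * (R / real n) \<le> real (2 * n) * (R / real n)"
      using that assms(4) by (intro mult_right_mono) auto
    also have "\<dots> = 2 * R" using that by simp
    finally show ?thesis .
  qed
  obtain h1 where h1: "h1 > 0"
    "\<And>h j. \<lbrakk>0 < h; h < h1; real (Suc j) * h \<le> 2 * R\<rbrakk> \<Longrightarrow> pos_def_mat (toeplitz_mat H h j)"
    using toeplitz_pos_def[OF B assms(1) KH] by blast
  have "\<forall>\<^sub>F n in sequentially. pos_def_mat (toeplitz_mat H (R / real n) n)"
    using small[OF h1(1)]
  proof eventually_elim
    case (elim n)
    show ?case by (rule h1(2)) (use elim size[of "Suc n" n] in auto)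
  qed
  moreover have "(\<lambda>n :: nat. SUP j \<in> {j :: nat. \<delta> < real j * (R / real n) \<and> real j * (R / real n) < R}.
         cmod (krein_coeff H (real j * (R / real n))
               - verblunsky H (R / real n) j / of_real (R / real n))) \<longlonglongrightarrow> 0"
    (is "(\<lambda>n. SUP j \<in> ?J n. ?f n j) \<longlonglongrightarrow> 0") if \<delta>: "0 < \<delta>" "\<delta> < R" for \<delta>
  proof (rule tendstoI)
    fix e :: real assume e: "e > 0"
    then have "e / 2 > 0" by simp
    then obtain h2 where h2: "h2 > 0"
      "\<And>h j. \<lbrakk>0 < h; h < h2; j \<ge> 1; real (j + 2) * h \<le> 2 * R\<rbrakk> \<Longrightarrow>
        cmod (krein_coeff H (real j * h) - verblunsky H h j / of_real h) \<le> e / 2"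
      using verblunsky_close[OF B assms(1) KH] by blast
    \<comment> \<open>A mesh below \<open>R - \<delta>\<close> puts \<open>n - 1\<close> into the
      index set, so the supremum is taken over a nonempty set.\<close>
    have "0 < min h2 (R - \<delta>)" using h2(1) \<delta> by simp
    from small[OF this] show "\<forall>\<^sub>F n in sequentially. dist (SUP j \<in> ?J n. ?f n j) 0 < e"
    proof eventually_elim
      case (elim n)
      have fe: "?f n j \<le> e / 2" if "j \<in> ?J n" for j
      proof (rule h2(2))
        show "1 \<le> j" using that \<delta> by (cases j) auto
        have "real j < real n" using that elim assms(4) by (simp add: field_simps)
        then show "real (j + 2) * (R / real n) \<le> 2 * R" by (intro size) (use elim in auto)
      qed (use elim in auto)
      have ne: "n - 1 \<in> ?J n" using elim assms(4) by (auto simp: of_nat_diff field_simps)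
      have "(SUP j \<in> ?J n. ?f n j) \<le> e / 2" using ne fe by (intro cSUP_least) auto
      moreover have "0 \<le> ?f n (n - 1)" by simp
      then have "0 \<le> (SUP j \<in> ?J n. ?f n j)"
        by (rule order_trans) (rule cSUP_upper[OF ne], use fe in \<open>auto intro!: bdd_aboveI[of _ "e / 2"]\<close>)
      ultimately show ?case using e by (simp add: dist_real_def)
    qed
  qed
  ultimately show ?thesis by blast
qed

end
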